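(* Let $g$ lie in $\mathcal{C}^p\cap\mathcal{D}^p\cap\mathcal{K}^p$ with $\deg g=p-1$ for some $p\in\mathbb{N}^*$. The following assertions hold. (a) $\gamma[g^{(p)}]=\sigma[g^{(p)}]=g^{(p-1)}(1)-(\Sigma g)^{(p)}(1)$. (b) For any $x>0$ we have $$\Sigma g(x)=\sum_{j=1}^{p-1}\binom{x}{j}\Delta^{j-1}g(1)+\binom{x}{p}(\Sigma g)^{(p)}(1)-g(x)-\sum_{k=1}^{\infty}\left(g(x+k)-\sum_{j=0}^{p-1}\binom{x}{j}\Delta^jg(k)-\binom{x}{p}g^{(p)}(k)\right)$$ and the series converges uniformly on any bounded subset of $[0,\infty)$. (c) The function $\Sigma g$ lies in $\mathcal{C}^p$ and the series above can be (repeatedly) integrated term by term on any bounded interval of $[0,\infty)$. (d) If $g$ lies in $\mathcal{C}^{\max\{p,r\}}\cap\mathcal{K}^{\max\{p,r\}}$ for some $r\in\mathbb{N}$, then $\Sigma g$ lies in $\mathcal{C}^{\max\{p,r\}}$ and the series above can be differentiated term by term up to $\max\{p,r\}$ times.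
   Context: $\mathbb{N}=\{0,1,2,\ldots\}$, $\mathbb{N}^*=\{1,2,\ldots\}$, $\mathbb{R}_+=(0,\infty)$, $\Delta f(x)=f(x+1)-f(x)$; $\mathcal{C}^r$ is the set of $r$ times continuously differentiable functions $\mathbb{R}_+\to\mathbb{R}$. For an integer $p\ge -1$, a function $f\colon I\to\mathbb{R}$ on a real interval $I$ is $p$-convex (resp. $p$-concave) if for all $x_0<\cdots<x_{p+1}$ in $I$ the divided difference $f[x_0,\ldots,x_{p+1}]$ is $\ge 0$ (resp. $\le 0$), where $f[x_0,\ldots,x_n]=\sum_{k=0}^n f(x_k)/\prod_{j\ne k}(x_k-x_j)$. $\mathcal{K}^p$ is the set of functions $\mathbb{R}_+\to\mathbb{R}$ that are $p$-convex on some $[a,\infty)$ or $p$-concave on some $[a,\infty)$. $\mathcal{D}^p$ is the set of $g\colon\mathbb{R}_+\to\mathbb{R}$ with $\Delta^pg(n)\to 0$ as $n\to\infty$ over the integers. For $g\in\mathcal{D}^p\cap\mathcal{K}^p$, the function $\Sigma g\colon\mathbb{R}_+\to\mathbb{R}$ is $$\Sigma g(x)=\lim_{n\to\infty}\Big(-g(x)+\sum_{k=1}^{n-1}(g(k)-g(x+k))+\sum_{j=1}^p\binom{x}{j}\Delta^{j-1}g(n)\Big);$$ the limit exists, does not depend on the choice of such $p$, and $\Sigma g$ is the unique solution $f\in\mathcal{K}^p$ of $\Delta f=g$ with $f(1)=0$; it is continuous if $g$ is. For continuous $g\in\bigcup_{p\ge0}(\mathcal{D}^p\cap\mathcal{K}^p)$: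 asymptotic constant $\sigma[g]=\int_0^1\Sigma g(t+1)\,dt$; asymptotic degree $\deg g=-1+\min\{q\in\mathbb{N}:\Delta^qg(x)\to0\text{ as }x\to\infty\}$ (real $x$); with $G_n=\int_0^1\binom{t}{n}dt$ and $J^q[f](x)=\sum_{j=0}^{q-1}G_j\Delta^jf(x)-\int_x^{x+1}f(t)\,dt$, the generalized Euler constant is $\gamma[g]=-J^{q+1}[\Sigma g](1)$ with $q=1+\deg g$. (Under the hypotheses, $g^{(p)}$ lies in $\mathcal{C}^0\cap\mathcal{D}^0\cap\mathcal{K}^0$, so $\sigma[g^{(p)}]$ and $\gamma[g^{(p)}]$ are defined.) *)

theory Defs
  imports "HOL-Analysis.Analysis"
begin

text \<open>Functions on the open half-line of positive reals are represented by total functions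
  \<^typ>\<open>real \<Rightarrow> real\<close>; nothing below depends on their values at nonpositive arguments. In
  particular \<open>(deriv ^^ k) f x\<close> for \<open>x > 0\<close> is the usual \<open>k\<close>-th derivative, because
  \<^const>\<open>deriv\<close> at a point depends only on \<open>f\<close> near that point.\<close>

definition fdiff :: "(real \<Rightarrow> real) \<Rightarrow> real \<Rightarrow> real" where
  "fdiff f x = f (x + 1) - f x"

definition divided_difference :: "(real \<Rightarrow> real) \<Rightarrow> (nat \<Rightarrow> real) \<Rightarrow> nat \<Rightarrow> real" where
  "divided_difference f x n = (\<Sum>k\<le>n. f (x k) / (\<Prod>j\<in>{..n} - {k}. x k - x j))"

definition pconvex_on :: "nat \<Rightarrow> real set \<Rightarrow> (real \<Rightarrow> real) \<Rightarrow> bool" where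
  "pconvex_on p I f \<longleftrightarrow>
     (\<forall>x. strict_mono_on {..p + 1} x \<and> x ` {..p + 1} \<subseteq> I \<longrightarrow> divided_difference f x (p + 1) \<ge> 0)"

definition pconcave_on :: "nat \<Rightarrow> real set \<Rightarrow> (real \<Rightarrow> real) \<Rightarrow> bool" where
  "pconcave_on p I f \<longleftrightarrow>
     (\<forall>x. strict_mono_on {..p + 1} x \<and> x ` {..p + 1} \<subseteq> I \<longrightarrow> divided_difference f x (p + 1) \<le> 0)"

definition C_class :: "nat \<Rightarrow> (real \<Rightarrow> real) set" where
  "C_class r = {f. (\<forall>k<r. \<forall>x>0. (deriv ^^ k) f differentiable (at x))
                   \<and> continuous_on {0<..} ((deriv ^^ r) f)}"

definition K_class :: "nat \<Rightarrow> (real \<Rightarrow> real) set" where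
  "K_class p = {f. \<exists>a>0. pconvex_on p {a..} f \<or> pconcave_on p {a..} f}"

definition D_class :: "nat \<Rightarrow> (real \<Rightarrow> real) set" where
  "D_class p = {g. (\<lambda>n::nat. (fdiff ^^ p) g (real n)) \<longlonglongrightarrow> 0}"

definition prin_sum_seq :: "nat \<Rightarrow> (real \<Rightarrow> real) \<Rightarrow> real \<Rightarrow> nat \<Rightarrow> real" where
  "prin_sum_seq p g x n =
     - g x + (\<Sum>k\<in>{1..<n}. g (real k) - g (x + real k))
     + (\<Sum>j\<in>{1..p}. (x gchoose j) * (fdiff ^^ (j - 1)) g (real n))"

text \<open>The principal indefinite sum \<open>\<Sigma>g\<close>, meaningful for \<open>g\<close> in \<open>D_class p \<inter> K_class p\<close>
  for some \<open>p\<close> and at \<open>x > 0\<close>. The limit does not depend on the choice of such a \<open>p\<close>; the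
  definition takes the least one.\<close>

definition prin_sum :: "(real \<Rightarrow> real) \<Rightarrow> real \<Rightarrow> real" where
  "prin_sum g x = lim (prin_sum_seq (LEAST p. g \<in> D_class p \<inter> K_class p) g x)"

definition asym_const :: "(real \<Rightarrow> real) \<Rightarrow> real" where
  "asym_const g = integral {0..1} (\<lambda>t. prin_sum g (t + 1))"

definition asym_deg :: "(real \<Rightarrow> real) \<Rightarrow> int" where
  "asym_deg g = - 1 + int (LEAST q. ((fdiff ^^ q) g \<longlongrightarrow> 0) at_top)"

definition gregory_coeff :: "nat \<Rightarrow> real" where
  "gregory_coeff n = integral {0..1} (\<lambda>t::real. t gchoose n)"

definition binet_fun :: "nat \<Rightarrow> (real \<Rightarrow> real) \<Rightarrow> real \<Rightarrow> real" where
  "binet_fun q f x = (\<Sum>j<q. gregory_coeff j * (fdiff ^^ j) f x) - integral {x..x + 1} f"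

definition gen_euler_const :: "(real \<Rightarrow> real) \<Rightarrow> real" where
  "gen_euler_const g = - binet_fun (nat (1 + asym_deg g) + 1) (prin_sum g) 1"

definition eulerian_term :: "nat \<Rightarrow> (real \<Rightarrow> real) \<Rightarrow> nat \<Rightarrow> real \<Rightarrow> real" where
  "eulerian_term p g k x =
     g (x + real k) - (\<Sum>j<p. (x gchoose j) * (fdiff ^^ j) g (real k))
     - (x gchoose p) * (deriv ^^ p) g (real k)"

text \<open>Iterated oriented integral with a list of base points:
  \<open>rep_integral [c\<^sub>1, \<dots>, c\<^sub>n] f x\<close> integrates \<open>f\<close> from \<open>c\<^sub>1\<close>, the result from \<open>c\<^sub>2\<close>, and so on,
  up to \<open>x\<close>. The difference of integrals is the oriented integral from \<open>c\<close> to \<open>x\<close>,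
  since one of the two intervals is empty or a single point.\<close>

fun rep_integral :: "real list \<Rightarrow> (real \<Rightarrow> real) \<Rightarrow> real \<Rightarrow> real" where
  "rep_integral [] f = f"
| "rep_integral (c # cs) f = rep_integral cs (\<lambda>x. integral {c..x} f - integral {x..c} f)"

text \<open>The series \<open>\<Sum>k. u k\<close> can be repeatedly integrated term by term on the interval \<open>I\<close>. The
  integrability conjuncts are needed because \<^const>\<open>integral\<close> is \<open>0\<close> on non-integrable functions.\<close>

definition termwise_integrable_on :: "(nat \<Rightarrow> real \<Rightarrow> real) \<Rightarrow> real set \<Rightarrow> bool" where
  "termwise_integrable_on u I \<longleftrightarrow>
     (\<forall>cs. set cs \<subseteq> I \<longrightarrow>
        (\<forall>a\<in>I. \<forall>b\<in>I. (\<forall>k. rep_integral cs (u k) integrable_on {a..b})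
                     \<and> rep_integral cs (\<lambda>x. \<Sum>k. u k x) integrable_on {a..b})
      \<and> (\<forall>x\<in>I. (\<lambda>k. rep_integral cs (u k) x) sums rep_integral cs (\<lambda>x. \<Sum>k. u k x) x))"

text \<open>The series \<open>\<Sum>k. u k\<close> can be differentiated term by term on \<open>A\<close> up to \<open>n\<close> times: for each
  \<open>m < n\<close> the sum of the \<open>m\<close>-th derivatives has the sum of the \<open>(m+1)\<close>-st ones as derivative.
  The derivative of the sum is taken within \<open>A\<close>, hence one-sided at a boundary point, whereas the
  individual terms are required to have two-sided derivatives at each point of \<open>A\<close>.\<close>

definition termwise_differentiable_on :: "nat \<Rightarrow> (nat \<Rightarrow> real \<Rightarrow> real) \<Rightarrow> real set \<Rightarrow> bool" where
  "termwise_differentiable_on n u A \<longleftrightarrow>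
     (\<forall>m\<le>n. \<forall>x\<in>A. summable (\<lambda>k. (deriv ^^ m) (u k) x))
   \<and> (\<forall>m<n. \<forall>x\<in>A. (\<forall>k. (deriv ^^ m) (u k) differentiable (at x))
        \<and> ((\<lambda>y. \<Sum>k. (deriv ^^ m) (u k) y) has_real_derivative (\<Sum>k. (deriv ^^ Suc m) (u k) x))
             (at x within A))"

end

theory Submission
  imports Defs
begin

text \<open>
  Write \<open>G = g\<^sup>(\<^sup>p\<^sup>)\<close>. Divided differences at equally spaced nodes are iterated differences, so
  \<open>p\<close>-convexity makes the differences of order \<open>p\<close> monotone along arithmetic progressions, and letting
  the step tend to zero shows that \<open>G\<close> is eventually monotone (\<open>K_class_imp_eventually_monotone\<close>). The
  numbers \<open>\<Delta>\<^sup>p g(n)\<close> are values of \<open>G\<close> at points that tend to infinity, hence \<open>G(x) \<rightarrow> 0\<close>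
  (\<open>degree_deriv_tendsto_0\<close>). Everything else rests on these two properties.

  The \<open>p\<close>-th derivative of the \<open>k\<close>-th term \<open>e\<^sub>k\<close> of the Eulerian series is the increment \<open>G(x + k) - G(k)\<close>. As
  \<open>G\<close> is eventually monotone with limit \<open>0\<close>, these increments are dominated on bounded sets by a
  convergent telescoping series. Moreover \<open>\<Delta>\<^sup>m e\<^sub>k(0) = 0\<close> for \<open>m < p\<close>, so by the mean value theorem for
  differences each lower derivative of \<open>e\<^sub>k\<close> has a zero in \<open>[0, p]\<close>, and integrating from that zero
  carries the bound down to all orders \<open>m \<le> p\<close> (\<open>normally_summable_eulerian_deriv\<close>). For orders
  \<open>m > p\<close>, under the stronger hypotheses of the last assertion, the derivatives of the terms are
  translates of \<open>g\<^sup>(\<^sup>m\<^sup>)\<close>, which is eventually monotone with limit \<open>0\<close> and dominated by increments of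
  \<open>g\<^sup>(\<^sup>m\<^sup>-\<^sup>1\<^sup>)\<close> (\<open>normally_summable_eulerian_deriv_above\<close>). Hence all series of derivatives converge normally on bounded sets,
  which yields uniform convergence and termwise integration and differentiation.

  Telescoping the differences \<open>\<Delta>\<^sup>j g(n)\<close> in the limit that defines \<open>\<Sigma>g\<close> gives the series
  representation, with the coefficient
  \<open>c = \<Delta>\<^sup>p\<^sup>-\<^sup>1 g(1) + (\<Sum>k\<ge>1. \<Delta>\<^sup>p g(k) - G(k))\<close> of \<open>x gchoose p\<close> (\<open>prin_sum_seq_eulerian\<close>). Differentiating
  \<open>p\<close> times leaves \<open>(\<Sigma>g)\<^sup>(\<^sup>p\<^sup>)(x) = c - G(x) - (\<Sum>k\<ge>1. G(x + k) - G(k)) = c + \<Sigma>G(x)\<close>, and this is \<open>c\<close> at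
  \<open>x = 1\<close>. Integrating this identity over \<open>[1, 2]\<close> and using \<open>\<Delta>\<Sigma>g = g\<close> gives the
  formula for \<open>\<sigma>[G]\<close> (\<open>asym_const_of_deriv\<close>).
\<close>

section \<open>Towers of derivatives\<close>

text \<open>
  \<open>F m\<close> stands for the \<open>m\<close>-th derivative of \<open>F 0\<close>. Explicit candidates for all derivatives
  are much easier to handle than iterates of \<^const>\<open>deriv\<close>: they can be shifted, subtracted and
  summed as a family, and \<open>higher_deriv_eq_tower\<close> returns to the iterates at the end.\<close>

definition derivative_tower :: "nat \<Rightarrow> (nat \<Rightarrow> real \<Rightarrow> real) \<Rightarrow> real set \<Rightarrow> bool" where
  "derivative_tower n F S \<longleftrightarrow>
     (\<forall>m<n. \<forall>x\<in>S. (F m has_real_derivative F (Suc m) x) (at x))"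

lemma derivative_towerD:
  "derivative_tower n F S \<Longrightarrow> m < n \<Longrightarrow> x \<in> S \<Longrightarrow> (F m has_real_derivative F (Suc m) x) (at x)"
  by (auto simp: derivative_tower_def)

lemma higher_deriv_eq_tower:
  assumes "open S" "derivative_tower n F S" "\<And>x. x \<in> S \<Longrightarrow> f x = F 0 x" "m \<le> n" "x \<in> S"
  shows "(deriv ^^ m) f x = F m x"
  using assms(4,5)
proof (induction m arbitrary: x)
  case 0
  then show ?case using assms(3) by simp
next
  case (Suc m)
  have "(F m has_real_derivative F (Suc m) x) (at x)"
    using Suc.prems by (intro derivative_towerD[OF assms(2)]) auto
  moreover have "F m y = (deriv ^^ m) f y" if "y \<in> S" for y
    using Suc.IH[of y] Suc.prems that by simp
  ultimately have "((deriv ^^ m) f has_real_derivative F (Suc m) x) (at x)"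
    using has_field_derivative_transform_within_open[OF _ assms(1) Suc.prems(2)] by blast
  then show ?case by (simp add: DERIV_imp_deriv)
qed

lemma higher_deriv_has_derivative:
  assumes "open S" "derivative_tower n F S" "\<And>x. x \<in> S \<Longrightarrow> f x = F 0 x" "m < n" "x \<in> S"
  shows "((deriv ^^ m) f has_real_derivative F (Suc m) x) (at x)"
proof -
  have "(F m has_real_derivative F (Suc m) x) (at x)"
    by (rule derivative_towerD[OF assms(2,4,5)])
  moreover have "F m y = (deriv ^^ m) f y" if "y \<in> S" for y
    using higher_deriv_eq_tower[OF assms(1,2), of f m y] assms(3,4) that by simp
  ultimately show ?thesis
    using has_field_derivative_transform_within_open[OF _ assms(1,5)] by blast
qed

lemma C_class_tower:
  assumes "g \<in> C_class n"
  shows "derivative_tower n (\<lambda>m. (deriv ^^ m) g) {0<..}"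
proof -
  have "((deriv ^^ m) g has_real_derivative (deriv ^^ Suc m) g x) (at x)" if "m < n" "x > 0" for m x
  proof -
    have "(deriv ^^ m) g differentiable (at x)"
      using assms that by (auto simp: C_class_def)
    then show ?thesis
      using DERIV_deriv_iff_real_differentiable by simp
  qed
  then show ?thesis by (auto simp: derivative_tower_def)
qed

text \<open>
  Only the values on the positive half-line enter, which is what makes the representation of
  functions on \<open>(0, \<infinity>)\<close> by total functions harmless.\<close>

lemma C_classI_tower:
  assumes "derivative_tower n F {0<..}" "\<And>x. x > 0 \<Longrightarrow> f x = F 0 x" "continuous_on {0<..} (F n)"
  shows "f \<in> C_class n"
proof -
  have eq: "(deriv ^^ m) f x = F m x" if "m \<le> n" "x > 0" for m x
    by (rule higher_deriv_eq_tower[OF open_greaterThan assms(1)]) (simp_all add: that assms(2))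
  have "continuous_on {0<..} ((deriv ^^ n) f)"
    by (rule continuous_on_eq[OF assms(3)]) (simp add: eq)
  moreover have "(deriv ^^ k) f differentiable (at x)" if "k < n" "x > 0" for k x
  proof -
    have "((deriv ^^ k) f has_real_derivative F (Suc k) x) (at x)"
      by (rule higher_deriv_has_derivative[OF open_greaterThan assms(1)])
         (simp_all add: that assms(2))
    then show ?thesis unfolding real_differentiable_def by blast
  qed
  ultimately show ?thesis by (simp add: C_class_def)
qed

lemma C_class_continuous_higher_deriv:
  assumes "g \<in> C_class n" "m \<le> n"
  shows "continuous_on {0<..} ((deriv ^^ m) g)"
proof (cases "m = n")
  case True
  then show ?thesis using assms by (simp add: C_class_def)
next
  case False
  then have "m < n" using assms(2) by simp
  then have "(deriv ^^ m) g differentiable (at x)" if "x > 0" for x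
    using assms(1) that unfolding C_class_def by blast
  then have "isCont ((deriv ^^ m) g) x" if "x > 0" for x
    using that differentiable_imp_continuous_within by blast
  then show ?thesis
    by (simp add: continuous_at_imp_continuous_on)
qed

lemma C_class_mono: "m \<le> n \<Longrightarrow> g \<in> C_class n \<Longrightarrow> g \<in> C_class m"
  using C_class_continuous_higher_deriv[of g n m] by (auto simp: C_class_def)

lemma derivative_tower_uminus:
  "derivative_tower n F S \<Longrightarrow> derivative_tower n (\<lambda>m x. - F m x) S"
  unfolding derivative_tower_def by (blast intro: DERIV_minus)

section \<open>Higher differences and higher convexity\<close>

definition step_diff :: "real \<Rightarrow> (real \<Rightarrow> real) \<Rightarrow> real \<Rightarrow> real" where
  "step_diff h f x = f (x + h) - f x"

lemma fdiff_eq_step_diff: "fdiff = step_diff 1"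
  by (intro ext) (simp add: fdiff_def step_diff_def)

text \<open>
  The mean value theorem for higher differences. By induction, the lemma for \<open>n\<close> is applied to the
  tower of first differences \<open>F m (x + h) - F m x\<close>, and the ordinary mean value theorem
  turns the resulting difference of \<open>F n\<close> into a value of \<open>F (n + 1)\<close>.\<close>

lemma step_diff_mvt:
  assumes "h > 0" "derivative_tower n F {x..x + real n * h}"
  shows "\<exists>\<xi>\<in>{x..x + real n * h}. (step_diff h ^^ n) (F 0) x = h ^ n * F n \<xi>"
  using assms(2)
proof (induction n arbitrary: F)
  case 0
  then show ?case by simp
next
  case (Suc n)
  let ?D = "\<lambda>m. step_diff h (F m)"
  have tw: "derivative_tower n ?D {x..x + real n * h}"
    unfolding derivative_tower_def
  proof (intro allI impI ballI)
    fix m y assume m: "m < n" and y: "y \<in> {x..x + real n * h}"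
    have "y \<in> {x..x + real (Suc n) * h}" "y + h \<in> {x..x + real (Suc n) * h}"
      using y \<open>h > 0\<close> by (auto simp: algebra_simps)
    then have "(F m has_real_derivative F (Suc m) y) (at y)"
      "(F m has_real_derivative F (Suc m) (y + h)) (at (y + h))"
      using m by (auto intro!: derivative_towerD[OF Suc.prems])
    then show "(?D m has_real_derivative ?D (Suc m) y) (at y)"
      unfolding step_diff_def by (auto simp: DERIV_shift intro: DERIV_diff)
  qed
  obtain \<xi> where \<xi>: "\<xi> \<in> {x..x + real n * h}"
    and eq: "(step_diff h ^^ n) (step_diff h (F 0)) x = h ^ n * step_diff h (F n) \<xi>"
    using Suc.IH[OF tw] by auto
  have "\<exists>z. \<xi> < z \<and> z < \<xi> + h \<and> F n (\<xi> + h) - F n \<xi> = (\<xi> + h - \<xi>) * F (Suc n) z"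
    using \<xi> \<open>h > 0\<close>
    by (intro MVT2) (auto intro!: derivative_towerD[OF Suc.prems] simp: algebra_simps)
  then obtain z where z: "\<xi> < z" "z < \<xi> + h" "F n (\<xi> + h) - F n \<xi> = h * F (Suc n) z"
    by auto
  have "z \<in> {x..x + real (Suc n) * h}"
    using z \<xi> by (auto simp: algebra_simps)
  moreover have "(step_diff h ^^ Suc n) (F 0) x = h ^ Suc n * F (Suc n) z"
    using eq z(3) by (simp add: funpow_Suc_right step_diff_def del: funpow.simps)
  ultimately show ?case by blast
qed

lemma fdiff_mvt:
  assumes "derivative_tower n F {x..x + real n}"
  shows "\<exists>\<xi>\<in>{x..x + real n}. (fdiff ^^ n) (F 0) x = F n \<xi>"
  using step_diff_mvt[of 1 n F x] assms by (simp add: fdiff_eq_step_diff)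

lemma step_diff_expand:
  "(step_diff h ^^ n) f x = (\<Sum>k\<le>n. (-1) ^ (n - k) * real (n choose k) * f (x + real k * h))"
proof (induction n arbitrary: x)
  case 0
  then show ?case by simp
next
  case (Suc n)
  let ?c = "\<lambda>k. (-1) ^ (n - k) * real (n choose k)"
  let ?f = "\<lambda>k. f (x + real k * h)"
  have "(step_diff h ^^ Suc n) f x
      = (\<Sum>k\<le>n. ?c k * ?f (Suc k)) - (\<Sum>k\<le>n. ?c k * ?f k)"
    by (simp add: step_diff_def[of h "(step_diff h ^^ n) f"] Suc.IH algebra_simps)
  also have "(\<Sum>k\<le>n. ?c k * ?f k) = ?c 0 * ?f 0 + (\<Sum>k\<le>n. ?c (Suc k) * ?f (Suc k))"
  proof -
    have "(\<Sum>k\<le>n. ?c k * ?f k) = (\<Sum>k\<le>Suc n. ?c k * ?f k)" by simp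
    also have "\<dots> = ?c 0 * ?f 0 + (\<Sum>k\<le>n. ?c (Suc k) * ?f (Suc k))"
      by (rule sum.atMost_Suc_shift)
    finally show ?thesis .
  qed
  also have "(\<Sum>k\<le>n. ?c k * ?f (Suc k)) - (?c 0 * ?f 0 + (\<Sum>k\<le>n. ?c (Suc k) * ?f (Suc k)))
      = (-1) ^ (Suc n) * ?f 0 + (\<Sum>k\<le>n. (?c k - ?c (Suc k)) * ?f (Suc k))"
    by (simp add: algebra_simps sum_subtractf)
  also have "(\<Sum>k\<le>n. (?c k - ?c (Suc k)) * ?f (Suc k))
      = (\<Sum>k\<le>n. (-1) ^ (Suc n - Suc k) * real (Suc n choose Suc k) * ?f (Suc k))"
  proof (rule sum.cong)
    fix k assume "k \<in> {..n}"
    then consider "k = n" | "k < n" by force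
    then show "(?c k - ?c (Suc k)) * ?f (Suc k)
        = (-1) ^ (Suc n - Suc k) * real (Suc n choose Suc k) * ?f (Suc k)"
    proof cases
      case 2
      then have "n - k = Suc (n - Suc k)" by simp
      then show ?thesis by (simp add: algebra_simps)
    qed simp
  qed simp
  also have "(-1) ^ (Suc n) * ?f 0 + \<dots>
      = (\<Sum>k\<le>Suc n. (-1) ^ (Suc n - k) * real (Suc n choose k) * ?f k)"
    by (subst sum.atMost_Suc_shift) simp
  finally show ?case .
qed

text \<open>
  The factors with \<open>j < k\<close> contribute \<open>k!\<close>, those with \<open>j > k\<close> contribute \<open>(n - k)!\<close> up to sign.\<close>

lemma prod_equispaced_nodes:
  assumes "k \<le> n"
  shows "(\<Prod>j\<in>{..n} - {k}. (x + real k * h) - (x + real j * h))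
       = h ^ n * (-1) ^ (n - k) * fact k * fact (n - k)"
proof -
  have "(\<Prod>j\<in>{..n} - {k}. (x + real k * h) - (x + real j * h))
      = (\<Prod>j\<in>{..n} - {k}. h * (real k - real j))"
    by (intro prod.cong) (auto simp: algebra_simps)
  also have "\<dots> = h ^ n * (\<Prod>j\<in>{..n} - {k}. real k - real j)"
    using assms by (simp add: prod.distrib)
  also have "(\<Prod>j\<in>{..n} - {k}. real k - real j)
      = (\<Prod>j<k. real k - real j) * (\<Prod>j\<in>{k<..n}. real k - real j)"
    using assms by (subst prod.union_disjoint[symmetric]) (auto intro!: prod.cong)
  also have "(\<Prod>j<k. real k - real j) = fact k"
  proof -
    have "(\<Prod>j<k. real k - real j) = (\<Prod>j<k. real (Suc j))"
      by (subst prod.nat_diff_reindex[symmetric]) (auto intro!: prod.cong simp: of_nat_diff)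
    also have "\<dots> = fact k"
      by (simp add: fact_prod_Suc atLeast0LessThan)
    finally show ?thesis .
  qed
  also have "(\<Prod>j\<in>{k<..n}. real k - real j) = (-1) ^ (n - k) * fact (n - k)"
  proof -
    have "(\<Prod>j\<in>{k<..n}. real k - real j) = (\<Prod>i<n - k. - real (Suc i))"
      by (rule prod.reindex_bij_witness[of _ "\<lambda>i. i + Suc k" "\<lambda>j. j - Suc k"]) auto
    also have "\<dots> = (\<Prod>i<n - k. (-1) * real (Suc i))" by simp
    also have "\<dots> = (-1) ^ (n - k) * fact (n - k)"
      by (simp only: prod.distrib fact_prod_Suc atLeast0LessThan) simp
    finally show ?thesis .
  qed
  finally show ?thesis by (simp add: mult_ac)
qed

text \<open>
  This is how \<open>p\<close>-convexity is put to use: only equally spaced nodes are needed below,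
  and there the divided difference is an iterated difference up to a positive factor.\<close>

lemma divided_difference_equispaced:
  assumes "h > 0"
  shows "divided_difference f (\<lambda>i. x + real i * h) n = (step_diff h ^^ n) f x / (h ^ n * fact n)"
proof -
  have "divided_difference f (\<lambda>i. x + real i * h) n
      = (\<Sum>k\<le>n. f (x + real k * h) / (h ^ n * (-1) ^ (n - k) * fact k * fact (n - k)))"
    unfolding divided_difference_def
    by (intro sum.cong refl) (simp only: prod_equispaced_nodes atMost_iff)
  also have "\<dots> = (\<Sum>k\<le>n. (-1) ^ (n - k) * real (n choose k) * f (x + real k * h)) / (h ^ n * fact n)"
    unfolding sum_divide_distrib
  proof (intro sum.cong refl)
    fix k assume "k \<in> {..n}"
    then have b: "real (n choose k) = fact n / (fact k * fact (n - k))"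
      by (simp add: binomial_fact)
    \<comment> \<open>The sign \<open>e = \<plusminus>1\<close> is its own inverse.\<close>
    have "c / (H * e * A * B) = e * (N / (A * B)) * c / (H * N)"
      if "e * e = 1" "N \<noteq> 0" for c H e A B N :: real
    proof -
      have "1 / e = e" using that(1) by (metis mult_cancel_right2 nonzero_eq_divide_eq zero_neq_one)
      have "c / (H * e * A * B) = (1 / e) * (c / (H * A * B))" by simp
      also have "\<dots> = e * (c / (H * A * B))" unfolding \<open>1 / e = e\<close> ..
      also have "\<dots> = e * (N / (A * B)) * c / (H * N)" using that(2) by simp
      finally show ?thesis .
    qed
    note cancel = this
    show "f (x + real k * h) / (h ^ n * (-1) ^ (n - k) * fact k * fact (n - k))
        = (-1) ^ (n - k) * real (n choose k) * f (x + real k * h) / (h ^ n * fact n)"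
      unfolding b by (rule cancel) simp_all
  qed
  finally show ?thesis by (simp add: step_diff_expand)
qed

text \<open>
  By \<open>p\<close>-convexity the difference of order \<open>p + 1\<close> is nonnegative, so the one of
  order \<open>p\<close> increases along each arithmetic progression of step \<open>h\<close>.\<close>

lemma pconvex_on_step_diff_mono:
  assumes "pconvex_on p {a..} f" "h > 0" "x \<ge> a"
  shows "(step_diff h ^^ p) f x \<le> (step_diff h ^^ p) f (x + real N * h)"
proof (induction N)
  case 0
  then show ?case by simp
next
  case (Suc N)
  let ?x = "x + real N * h"
  have "strict_mono_on {..p + 1} (\<lambda>i. ?x + real i * h)"
    using \<open>h > 0\<close> by (intro monotone_onI) simp
  moreover have "a \<le> ?x + real i * h" for i
  proof -
    have "0 \<le> real N * h" "0 \<le> real i * h" using \<open>h > 0\<close> by simp_all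
    then show ?thesis using \<open>x \<ge> a\<close> by linarith
  qed
  ultimately have "0 \<le> divided_difference f (\<lambda>i. ?x + real i * h) (p + 1)"
    using assms(1) unfolding pconvex_on_def by blast
  also have "\<dots> = (step_diff h ^^ Suc p) f ?x / (h ^ Suc p * fact (Suc p))"
    using divided_difference_equispaced[of h f ?x "Suc p"] assms by simp
  finally have *: "0 \<le> (step_diff h ^^ Suc p) f ?x / (h ^ Suc p * fact (Suc p))" .
  have "h ^ Suc p * fact (Suc p) > 0" using \<open>h > 0\<close> by (intro mult_pos_pos) simp_all
  with * have "0 \<le> (step_diff h ^^ Suc p) f ?x"
    by (metis not_le divide_neg_pos)
  then have "(step_diff h ^^ p) f ?x \<le> (step_diff h ^^ p) f (?x + h)"
    by (simp add: step_diff_def[of h "(step_diff h ^^ p) f"])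
  also have "?x + h = x + real (Suc N) * h" by (simp add: algebra_simps)
  finally show ?case using Suc by simp
qed

text \<open>
  For \<open>u < v\<close> choose steps \<open>h\<close> that divide \<open>v - u\<close>. The difference quotients of order \<open>p\<close>
  with step \<open>h\<close> at \<open>u\<close> and \<open>v\<close> are then comparable, and as \<open>h \<rightarrow> 0\<close> they tend to the
  values of the \<open>p\<close>-th derivative by the mean value theorem for differences.\<close>

lemma pconvex_on_imp_mono_on:
  assumes conv: "pconvex_on p {a..} (F 0)" and "a > 0"
    and tw: "derivative_tower p F {0<..}" and cont: "continuous_on {0<..} (F p)"
  shows "mono_on {a..} (F p)"
proof (rule monotone_onI)
  fix u v assume "u \<in> {a..}" "v \<in> {a..}" and "u \<le> v"
  show "F p u \<le> F p v"
  proof (cases "u = v")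
    case False
    then have "u < v" using \<open>u \<le> v\<close> by simp
    define h where "h N = (v - u) / real (Suc N)" for N
    have hpos: "h N > 0" for N using \<open>u < v\<close> by (simp add: h_def)
    have h0: "h \<longlonglongrightarrow> 0" unfolding h_def
      using LIMSEQ_inverse_real_of_nat tendsto_mult_right_zero[of "\<lambda>n. inverse (real (Suc n))" sequentially "v - u"]
      by (simp add: divide_inverse)
    have quot: "(\<lambda>N. (step_diff (h N) ^^ p) (F 0) w / h N ^ p) \<longlonglongrightarrow> F p w" if "w > 0" for w
    proof -
      have "\<exists>\<xi>\<in>{w..w + real p * h N}. (step_diff (h N) ^^ p) (F 0) w = h N ^ p * F p \<xi>" for N
        using tw \<open>w > 0\<close> by (intro step_diff_mvt hpos) (auto simp: derivative_tower_def)
      then obtain \<xi> where \<xi>: "\<And>N. \<xi> N \<in> {w..w + real p * h N}"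
        "\<And>N. (step_diff (h N) ^^ p) (F 0) w = h N ^ p * F p (\<xi> N)" by metis
      have "(\<lambda>N. w + real p * h N) \<longlonglongrightarrow> w + real p * 0"
        by (intro tendsto_intros h0)
      then have "\<xi> \<longlonglongrightarrow> w"
        using \<xi>(1) by (intro tendsto_sandwich[of "\<lambda>_. w" \<xi> sequentially "\<lambda>N. w + real p * h N"]) auto
      moreover have "isCont (F p) w"
        using cont \<open>w > 0\<close> by (simp add: continuous_on_eq_continuous_at)
      ultimately have "(\<lambda>N. F p (\<xi> N)) \<longlonglongrightarrow> F p w"
        by (rule isCont_tendsto_compose[rotated])
      moreover have "(step_diff (h N) ^^ p) (F 0) w / h N ^ p = F p (\<xi> N)" for N
        using \<xi>(2)[of N] hpos[of N] by simp
      ultimately show ?thesis by simp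
    qed
    have "(step_diff (h N) ^^ p) (F 0) u / h N ^ p \<le> (step_diff (h N) ^^ p) (F 0) v / h N ^ p" for N
    proof -
      have "u + real (Suc N) * h N = v" by (simp add: h_def)
      then show ?thesis
        using pconvex_on_step_diff_mono[OF conv hpos, of u N "Suc N"] \<open>u \<in> {a..}\<close> hpos[of N]
        by (intro divide_right_mono) auto
    qed
    moreover have "u > 0" "v > 0" using \<open>u \<in> {a..}\<close> \<open>v \<in> {a..}\<close> \<open>a > 0\<close> by auto
    ultimately show ?thesis
      by (intro LIMSEQ_le[OF quot quot]) auto
  qed simp
qed

section \<open>Eventually monotone functions\<close>

definition eventually_monotone :: "(real \<Rightarrow> real) \<Rightarrow> bool" where
  "eventually_monotone f \<longleftrightarrow> (\<exists>a. mono_on {a..} f \<or> antimono_on {a..} f)"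

text \<open>
  Every statement about such functions that is invariant under a change of sign needs to be proved
  for increasing functions only.\<close>

lemma eventually_monotone_wlog [consumes 1, case_names mono uminus]:
  assumes "eventually_monotone f"
    and mono: "\<And>f a. mono_on {a..} f \<Longrightarrow> P f"
    and uminus: "\<And>f. P (\<lambda>x. - f x) \<Longrightarrow> P f"
  shows "P f"
proof -
  obtain a where "mono_on {a..} f \<or> antimono_on {a..} f"
    using assms(1) by (auto simp: eventually_monotone_def)
  then show ?thesis
  proof
    assume "antimono_on {a..} f"
    then have "mono_on {a..} (\<lambda>x. - f x)" by (auto simp: monotone_on_def)
    then show ?thesis by (rule uminus[OF mono])
  qed (rule mono)
qed

lemma eventually_monotone_uminus_iff:
  "eventually_monotone (\<lambda>x. - f x) \<longleftrightarrow> eventually_monotone f"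
  by (auto simp: eventually_monotone_def monotone_on_def)

lemma K_class_imp_eventually_monotone:
  assumes "g \<in> C_class p" "g \<in> K_class p"
  shows "eventually_monotone ((deriv ^^ p) g)"
proof -
  let ?F = "\<lambda>m. (deriv ^^ m) g"
  have tw: "derivative_tower p ?F {0<..}" and ct: "continuous_on {0<..} (?F p)"
    using assms(1) C_class_tower C_class_continuous_higher_deriv by auto
  obtain a where a: "a > 0" and "pconvex_on p {a..} g \<or> pconcave_on p {a..} g"
    using assms(2) by (auto simp: K_class_def)
  from this(2) show ?thesis
  proof
    assume "pconvex_on p {a..} g"
    then have "mono_on {a..} (?F p)"
      using a tw ct by (intro pconvex_on_imp_mono_on) auto
    then show ?thesis by (auto simp: eventually_monotone_def)
  next
    assume "pconcave_on p {a..} g"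
    then have "pconvex_on p {a..} (\<lambda>x. - g x)"
      by (auto simp: pconcave_on_def pconvex_on_def divided_difference_def sum_negf)
    then have "mono_on {a..} (\<lambda>x. - ?F p x)"
      using a tw ct
      by (intro pconvex_on_imp_mono_on[where F = "\<lambda>m x. - ?F m x"])
         (auto intro: derivative_tower_uminus continuous_on_minus)
    then have "eventually_monotone (\<lambda>x. - ?F p x)" by (auto simp: eventually_monotone_def)
    then show ?thesis by (simp only: eventually_monotone_uminus_iff)
  qed
qed

lemma eventually_monotone_imp_K_class_0:
  assumes "eventually_monotone f"
  shows "f \<in> K_class 0"
proof -
  have dd: "divided_difference f x 1 = (f (x 1) - f (x 0)) / (x 1 - x 0)" if "x 0 < x 1"
    for f and x :: "nat \<Rightarrow> real"
  proof -
    have "{..Suc 0} - {0} = {1}" "{..Suc 0} - {1} = {0}" by auto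
    then have "divided_difference f x 1 = f (x 0) / (x 0 - x 1) + f (x 1) / (x 1 - x 0)"
      by (simp add: divided_difference_def)
    also have "f (x 0) / (x 0 - x 1) = - f (x 0) / (x 1 - x 0)"
      by (metis minus_diff_eq minus_divide_divide minus_minus)
    finally show ?thesis by (simp add: diff_divide_distrib)
  qed
  obtain a where a: "mono_on {a..} f \<or> antimono_on {a..} f"
    using assms by (auto simp: eventually_monotone_def)
  \<comment> \<open>The half-line in the definition of \<^const>\<open>K_class\<close> must start at a positive point.\<close>
  define b where "b = max a 1"
  have x: "x 0 < x 1 \<and> a \<le> x 0 \<and> a \<le> x 1"
    if "strict_mono_on {..0 + 1} x" "x ` {..0 + 1} \<subseteq> {b..}" for x :: "nat \<Rightarrow> real"
    using that by (auto simp: b_def monotone_on_def image_subset_iff)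
  from a have "pconvex_on 0 {b..} f \<or> pconcave_on 0 {b..} f"
  proof
    assume m: "mono_on {a..} f"
    have "pconvex_on 0 {b..} f" unfolding pconvex_on_def
    proof (intro allI impI, elim conjE)
      fix x :: "nat \<Rightarrow> real" assume "strict_mono_on {..0 + 1} x" "x ` {..0 + 1} \<subseteq> {b..}"
      with x have x: "x 0 < x 1" "a \<le> x 0" "a \<le> x 1" by blast+
      then have "f (x 0) \<le> f (x 1)" using m by (auto intro: monotone_onD)
      then show "0 \<le> divided_difference f x (0 + 1)" using dd[of x f] x by simp
    qed
    then show ?thesis ..
  next
    assume m: "antimono_on {a..} f"
    have "pconcave_on 0 {b..} f" unfolding pconcave_on_def
    proof (intro allI impI, elim conjE)
      fix x :: "nat \<Rightarrow> real" assume "strict_mono_on {..0 + 1} x" "x ` {..0 + 1} \<subseteq> {b..}"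
      with x have x: "x 0 < x 1" "a \<le> x 0" "a \<le> x 1" by blast+
      then have "f (x 1) \<le> f (x 0)" using m by (auto intro: monotone_onD)
      then show "divided_difference f x (0 + 1) \<le> 0" using dd[of x f] x by (simp add: divide_le_0_iff)
    qed
    then show ?thesis ..
  qed
  moreover have "b > 0" by (simp add: b_def)
  ultimately show ?thesis by (auto simp: K_class_def)
qed

text \<open>
  Any real point beyond \<open>\<xi> N\<close> lies between two sample points, so monotonicity traps the value of
  \<open>f\<close> between two small values.\<close>

lemma eventually_monotone_tendsto_0:
  assumes "eventually_monotone f" "filterlim \<xi> at_top sequentially" "(\<lambda>n. f (\<xi> n)) \<longlonglongrightarrow> 0"
  shows "(f \<longlongrightarrow> 0) at_top"
  using assms(1,3)
proof (induction rule: eventually_monotone_wlog)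
  case (mono f a)
  show ?case
  proof (rule tendstoI)
    fix e :: real assume "e > 0"
    then have "\<forall>\<^sub>F n in sequentially. dist (f (\<xi> n)) 0 < e"
      using mono(2) by (auto dest: tendstoD)
    moreover have "\<forall>\<^sub>F n in sequentially. \<xi> n \<ge> a"
      using assms(2) by (auto simp: filterlim_at_top)
    ultimately have "\<forall>\<^sub>F n in sequentially. dist (f (\<xi> n)) 0 < e \<and> \<xi> n \<ge> a"
      by eventually_elim simp
    then obtain N where N: "\<And>n. n \<ge> N \<Longrightarrow> \<bar>f (\<xi> n)\<bar> < e \<and> \<xi> n \<ge> a"
      by (auto simp: eventually_sequentially)
    have "dist (f x) 0 < e" if "x \<ge> \<xi> N" for x
    proof -
      have "\<forall>\<^sub>F n in sequentially. \<xi> n \<ge> x"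
        using assms(2) by (auto simp: filterlim_at_top)
      then obtain n where "n \<ge> N" "\<xi> n \<ge> x"
        by (metis eventually_sequentially nle_le)
      then have "f (\<xi> N) \<le> f x" "f x \<le> f (\<xi> n)"
        using N[of N] that by (auto intro!: monotone_onD[OF mono(1)])
      then show ?thesis using N[of N] N[of n] \<open>n \<ge> N\<close> by auto
    qed
    then show "\<forall>\<^sub>F x in at_top. dist (f x) 0 < e"
      by (auto simp: eventually_at_top_linorder)
  qed
next
  case (uminus f)
  have "(\<lambda>n. - f (\<xi> n)) \<longlonglongrightarrow> 0" using tendsto_minus[OF uminus(2)] by simp
  then have "((\<lambda>x. - f x) \<longlongrightarrow> 0) at_top" by (rule uminus(1))
  then show ?case using tendsto_minus_cancel_left[of f 0] by simp
qed

text \<open>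
  A monotone derivative has an eventually constant sign.\<close>

lemma eventually_monotone_antiderivative:
  assumes "\<And>x. x > 0 \<Longrightarrow> (f has_real_derivative f' x) (at x)" "eventually_monotone f'"
  shows "eventually_monotone f"
  using assms(2,1)
proof (induction arbitrary: f rule: eventually_monotone_wlog)
  case (mono f' a)
  show ?case
  proof (cases "\<exists>b>max a 0. f' b \<ge> 0")
    case True
    then obtain b where b: "b > max a 0" "f' b \<ge> 0" by blast
    then have nn: "f' x \<ge> 0" if "x \<ge> b" for x
      using monotone_onD[OF mono(1), of b x] that by simp
    have "mono_on {b..} f"
    proof (rule monotone_onI)
      fix u v assume "u \<in> {b..}" "v \<in> {b..}" "u \<le> v"
      have "\<exists>y. (f has_real_derivative y) (at x) \<and> 0 \<le> y" if "u \<le> x" "x \<le> v" for x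
      proof (intro exI conjI)
        show "(f has_real_derivative f' x) (at x)" "0 \<le> f' x"
          using b that \<open>u \<in> {b..}\<close> by (auto intro: mono(2) nn)
      qed
      then show "f u \<le> f v" by (rule DERIV_nonneg_imp_nondecreasing[OF \<open>u \<le> v\<close>])
    qed
    then show ?thesis by (auto simp: eventually_monotone_def)
  next
    case False
    have "antimono_on {max a 0 + 1..} f"
    proof (rule monotone_onI)
      fix u v assume uv: "u \<in> {max a 0 + 1..}" "v \<in> {max a 0 + 1..}" "u \<le> v"
      have np: "f' x \<le> 0" if "x \<ge> max a 0 + 1" for x
      proof -
        have "x > max a 0" using that by linarith
        then have "\<not> 0 \<le> f' x" using False by blast
        then show ?thesis by simp
      qed
      have "\<exists>y. (f has_real_derivative y) (at x) \<and> y \<le> 0" if "u \<le> x" "x \<le> v" for x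
      proof (intro exI conjI)
        show "(f has_real_derivative f' x) (at x)" "f' x \<le> 0"
          using that uv(1) by (auto intro: mono(2) np)
      qed
      then show "f v \<le> f u" by (rule DERIV_nonpos_imp_nonincreasing[OF uv(3)])
    qed
    then show ?thesis by (auto simp: eventually_monotone_def)
  qed
next
  case (uminus f' f)
  have "eventually_monotone (\<lambda>x. - f x)"
    by (rule uminus(1)) (rule DERIV_minus[OF uminus(2)])
  then show ?case by (simp only: eventually_monotone_uminus_iff)
qed

text \<open>
  The increments \<open>f (n + 1) - f n\<close> tend to zero, and they are values of \<open>f'\<close> at points that tend to
  infinity.\<close>

lemma eventually_monotone_derivative_tendsto_0:
  assumes der: "\<And>x. x > 0 \<Longrightarrow> (f has_real_derivative f' x) (at x)"
    and "eventually_monotone f'" "(f \<longlongrightarrow> 0) at_top"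
  shows "(f' \<longlongrightarrow> 0) at_top"
proof -
  have "\<exists>\<xi>>real (Suc n). f (real (Suc n) + 1) - f (real (Suc n)) = f' \<xi>" for n
    using MVT2[of "real (Suc n)" "real (Suc n) + 1" f f'] der by auto
  then obtain \<xi> where \<xi>: "\<And>n. real (Suc n) < \<xi> n"
    "\<And>n. f (real (Suc n) + 1) - f (real (Suc n)) = f' (\<xi> n)"
    by metis
  have at_top: "filterlim (\<lambda>n. real (n + k)) at_top sequentially" for k
    by (rule filterlim_compose[OF filterlim_real_sequentially filterlim_add_const_nat_at_top])
  have "(\<lambda>n. f (real (n + 2)) - f (real (n + 1))) \<longlonglongrightarrow> 0 - 0"
    by (intro tendsto_diff filterlim_compose[OF assms(3)] at_top)
  moreover have "f (real (n + 2)) - f (real (n + 1)) = f' (\<xi> n)" for n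
    using \<xi>(2)[of n] by (simp add: add_ac)
  ultimately have "(\<lambda>n. f' (\<xi> n)) \<longlonglongrightarrow> 0" by simp
  moreover have "filterlim \<xi> at_top sequentially"
  proof (rule filterlim_at_top_mono)
    show "filterlim (\<lambda>n. real (Suc n)) at_top sequentially" using at_top[of 1] by simp
    show "\<forall>\<^sub>F n in sequentially. real (Suc n) \<le> \<xi> n" by (intro always_eventually allI less_imp_le \<xi>(1))
  qed
  ultimately show ?thesis using assms(2) eventually_monotone_tendsto_0 by blast
qed

section \<open>Normal convergence on bounded subsets of the half-line\<close>

text \<open>
  Normal convergence on the bounded subsets of \<open>[0, \<infinity>)\<close>. Finitely many terms are left unbounded,
  because the functions of interest are monotone only eventually.\<close>

definition normally_summable :: "(nat \<Rightarrow> real \<Rightarrow> real) \<Rightarrow> bool" where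
  "normally_summable u \<longleftrightarrow>
     (\<forall>X. \<exists>M. summable M \<and> (\<forall>\<^sub>F k in sequentially. \<forall>x\<in>{0..X}. \<bar>u k x\<bar> \<le> M k))"

lemma normally_summable_imp_summable:
  assumes "normally_summable u" "x \<ge> 0"
  shows "summable (\<lambda>k. u k x)"
proof -
  obtain M where M: "summable M" "\<forall>\<^sub>F k in sequentially. \<forall>y\<in>{0..x}. \<bar>u k y\<bar> \<le> M k"
    using assms(1) unfolding normally_summable_def by blast
  from M(2) have "\<forall>\<^sub>F k in sequentially. norm (u k x) \<le> M k"
    by eventually_elim (use assms(2) in simp)
  then show ?thesis using M(1) by (rule summable_comparison_test_ev)
qed

lemma normally_summable_uniform_limit:
  assumes "normally_summable u" "bounded S" "S \<subseteq> {0..}"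
  shows "uniform_limit S (\<lambda>n x. \<Sum>k<n. u k x) (\<lambda>x. \<Sum>k. u k x) sequentially"
proof -
  obtain X where X: "\<And>x. x \<in> S \<Longrightarrow> \<bar>x\<bar> \<le> X"
    using assms(2) by (auto simp: bounded_iff)
  obtain M where M: "summable M" "\<forall>\<^sub>F k in sequentially. \<forall>y\<in>{0..X}. \<bar>u k y\<bar> \<le> M k"
    using assms(1) unfolding normally_summable_def by blast
  have "S \<subseteq> {0..X}" using X assms(3) by force
  with M(2) have "\<forall>\<^sub>F k in sequentially. \<forall>y\<in>S. norm (u k y) \<le> M k"
    by (auto elim!: eventually_mono)
  then show ?thesis using M(1) by (rule Weierstrass_m_test_ev)
qed

text \<open>
  Uniform convergence is available on bounded sets only; this identity carries continuity and
  differentiability over from segments to the half-line, including the end point \<open>0\<close>.\<close>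

lemma at_within_atLeast_eq_segment:
  fixes x :: real
  assumes "0 \<le> x"
  shows "at x within {0..x + 1} = at x within {0..}"
  by (rule at_within_nhd[of x "{..<x + 1}"]) auto

lemma normally_summable_continuous_on:
  assumes "normally_summable u" "\<And>k. continuous_on {0..} (u k)"
  shows "continuous_on {0..} (\<lambda>x. \<Sum>k. u k x)"
  unfolding continuous_on_eq_continuous_within
proof
  fix x :: real assume x: "x \<in> {0..}"
  have "continuous_on {0..x + 1} (\<lambda>x. \<Sum>k. u k x)"
  proof (rule uniform_limit_theorem)
    show "uniform_limit {0..x + 1} (\<lambda>n x. \<Sum>k<n. u k x) (\<lambda>x. \<Sum>k. u k x) sequentially"
      by (rule normally_summable_uniform_limit[OF assms(1)]) auto
    have "continuous_on {0..x + 1} (u k)" for k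
      by (rule continuous_on_subset[OF assms(2)]) auto
    then show "\<forall>\<^sub>F n in sequentially. continuous_on {0..x + 1} (\<lambda>x. \<Sum>k<n. u k x)"
      by (intro always_eventually allI continuous_on_sum)
  qed simp
  then have "continuous (at x within {0..x + 1}) (\<lambda>x. \<Sum>k. u k x)"
    using x by (auto simp: continuous_on_eq_continuous_within)
  then show "continuous (at x within {0..}) (\<lambda>x. \<Sum>k. u k x)"
    using x by (simp add: at_within_atLeast_eq_segment)
qed

lemma normally_summable_has_derivative:
  assumes "normally_summable u" "normally_summable u'"
    and der: "\<And>k x. x \<ge> 0 \<Longrightarrow> (u k has_real_derivative u' k x) (at x)"
    and x: "x \<ge> 0"
  shows "((\<lambda>x. \<Sum>k. u k x) has_real_derivative (\<Sum>k. u' k x)) (at x within {0..})"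
proof -
  let ?S = "{0..x + 1}"
  have "uniform_limit ?S (\<lambda>n x. \<Sum>k<n. u' k x) (\<lambda>x. \<Sum>k. u' k x) sequentially"
    by (rule normally_summable_uniform_limit[OF assms(2)]) auto
  moreover have "(u k has_real_derivative u' k y) (at y within ?S)" if "y \<in> ?S" for k y
    using der[of y k] that by (simp add: has_field_derivative_at_within)
  moreover have "summable (\<lambda>k. u k 0)"
    by (rule normally_summable_imp_summable[OF assms(1)]) simp
  ultimately obtain s where
    s: "\<forall>y\<in>?S. (\<lambda>k. u k y) sums s y \<and> (s has_real_derivative (\<Sum>k. u' k y)) (at y within ?S)"
    using has_field_derivative_series[of ?S u u' "\<lambda>x. \<Sum>k. u' k x" 0] x by auto
  have "((\<lambda>y. \<Sum>k. u k y) has_real_derivative (\<Sum>k. u' k x)) (at x within ?S)"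
  proof (rule has_field_derivative_transform_within[where d = 1])
    show "(s has_real_derivative (\<Sum>k. u' k x)) (at x within ?S)" using s x by auto
    show "s y = (\<Sum>k. u k y)" if "y \<in> ?S" for y using s that sums_unique by blast
  qed (use x in auto)
  then show ?thesis using x by (simp add: at_within_atLeast_eq_segment)
qed

text \<open>
  If \<open>f\<close> is eventually increasing, \<open>0 \<le> x \<le> N\<close> and \<open>k\<close> is large, then \<open>0 \<le> f (x + k) - f k \<le> f (k + N) - f k\<close>, and the right-hand side is
  a sum of \<open>N\<close> telescoping series, which converge as \<open>f\<close> has a limit.\<close>

lemma normally_summable_increments:
  assumes "eventually_monotone f" "(f \<longlongrightarrow> 0) at_top"
  shows "normally_summable (\<lambda>k x. f (x + real (Suc k)) - f (real (Suc k)))"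
  using assms
proof (induction rule: eventually_monotone_wlog)
  case (mono f a)
  show ?case unfolding normally_summable_def
  proof
    fix X :: real
    obtain N :: nat where N: "X \<le> real N" using real_arch_simple by blast
    define M where "M k = f (real (Suc k + N)) - f (real (Suc k))" for k
    have M: "M = (\<lambda>k. \<Sum>i<N. f (real (Suc (k + Suc i))) - f (real (Suc (k + i))))"
      unfolding M_def using sum_lessThan_telescope[of "\<lambda>i. f (real (Suc (_ + i)))" N]
      by (intro ext) simp
    have "summable (\<lambda>k. f (real (Suc (k + Suc i))) - f (real (Suc (k + i))))" for i
    proof -
      have "(\<lambda>k. f (real (k + Suc i))) \<longlonglongrightarrow> 0"
        by (intro filterlim_compose[OF mono(2)]
            filterlim_compose[OF filterlim_real_sequentially filterlim_add_const_nat_at_top])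
      from telescope_summable[OF this] show ?thesis by simp
    qed
    then have "summable M" unfolding M by (intro summable_sum)
    moreover have "\<bar>f (x + real (Suc k)) - f (real (Suc k))\<bar> \<le> M k"
      if "x \<in> {0..X}" "real k \<ge> a" for x k
    proof -
      have "f (real (Suc k)) \<le> f (x + real (Suc k))"
        by (rule monotone_onD[OF mono(1)]) (use that in auto)
      moreover have "f (x + real (Suc k)) \<le> f (real (Suc k + N))"
        by (rule monotone_onD[OF mono(1)]) (use that N in auto)
      ultimately show ?thesis by (simp add: M_def)
    qed
    moreover have "\<forall>\<^sub>F k in sequentially. real k \<ge> a"
      using filterlim_real_sequentially by (simp add: filterlim_at_top)
    ultimately show "\<exists>M. summable M \<and>
        (\<forall>\<^sub>F k in sequentially. \<forall>x\<in>{0..X}. \<bar>f (x + real (Suc k)) - f (real (Suc k))\<bar> \<le> M k)"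
      by (intro exI[of _ M] conjI) (auto elim!: eventually_mono)
  qed
next
  case (uminus f)
  have "normally_summable (\<lambda>k x. - f (x + real (Suc k)) - - f (real (Suc k)))"
    using uminus(1) tendsto_minus[OF uminus(2)] by simp
  then show ?case by (simp add: normally_summable_def abs_minus_commute)
qed

text \<open>
  If \<open>f'\<close> eventually increases to \<open>0\<close>, then for large \<open>k\<close> it is nonpositive and \<open>\<bar>f' (x + k + 1)\<bar>\<close> is at most
  \<open>\<bar>f' z\<bar>\<close> for every \<open>z\<close> in \<open>(k, k + 1)\<close>, hence at most the decrease of \<open>f\<close> over \<open>[k, k + 1]\<close>. These
  decreases telescope.\<close>

lemma normally_summable_translates_of_derivative:
  assumes "eventually_monotone f'" "(f' \<longlongrightarrow> 0) at_top" "(f \<longlongrightarrow> 0) at_top"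
    and der: "\<And>x. x > 0 \<Longrightarrow> (f has_real_derivative f' x) (at x)"
  shows "normally_summable (\<lambda>k x. f' (x + real (Suc k)))"
  using assms
proof (induction arbitrary: f rule: eventually_monotone_wlog)
  case (mono f' a)
  have nonpos: "f' x \<le> 0" if "x \<ge> a" for x
  proof (rule tendsto_lowerbound[OF mono(2)])
    show "\<forall>\<^sub>F y in at_top. f' x \<le> f' y"
      using eventually_ge_at_top[of x]
      by eventually_elim (rule monotone_onD[OF mono(1)], use that in auto)
  qed simp
  define M where "M k = f (real k) - f (real (Suc k))" for k
  have "(\<lambda>k. f (real k)) \<longlonglongrightarrow> 0"
    by (rule filterlim_compose[OF mono(3) filterlim_real_sequentially])
  then have "summable M"
    unfolding M_def[abs_def] by (rule telescope_summable')
  have bound: "\<bar>f' (x + real (Suc k))\<bar> \<le> M k" if "x \<ge> 0" "real k \<ge> max a 1" for x k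
  proof -
    have k: "k > 0" "real k \<ge> a" using that by auto
    have "\<exists>z>real k. z < real k + 1 \<and> f (real k + 1) - f (real k) = (real k + 1 - real k) * f' z"
      by (rule MVT2) (use mono(4) k in auto)
    then obtain z where z: "z > real k" "z < real k + 1" "f (real k + 1) - f (real k) = f' z"
      by auto
    have "f' z \<le> f' (x + real (Suc k))"
      by (rule monotone_onD[OF mono(1)]) (use z that in auto)
    moreover have "f' (x + real (Suc k)) \<le> 0" by (rule nonpos) (use that in auto)
    moreover have "M k = - f' z"
      using z(3) k by (simp add: M_def add_ac)
    ultimately show ?thesis by simp
  qed
  have ev: "\<forall>\<^sub>F k in sequentially. real k \<ge> max a 1"
    using filterlim_real_sequentially unfolding filterlim_at_top by blast
  show ?case unfolding normally_summable_def
  proof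
    fix X
    from ev have "\<forall>\<^sub>F k in sequentially. \<forall>x\<in>{0..X}. \<bar>f' (x + real (Suc k))\<bar> \<le> M k"
      by eventually_elim (use bound in auto)
    with \<open>summable M\<close> show "\<exists>M. summable M \<and>
        (\<forall>\<^sub>F k in sequentially. \<forall>x\<in>{0..X}. \<bar>f' (x + real (Suc k))\<bar> \<le> M k)" by blast
  qed
next
  case (uminus f' f)
  have "normally_summable (\<lambda>k x. - f' (x + real (Suc k)))"
  proof (rule uminus(1))
    show "((\<lambda>x. - f' x) \<longlongrightarrow> 0) at_top" using tendsto_minus[OF uminus(2)] by simp
    show "((\<lambda>x. - f x) \<longlongrightarrow> 0) at_top" using tendsto_minus[OF uminus(3)] by simp
    show "((\<lambda>x. - f x) has_real_derivative - f' x) (at x)" if "x > 0" for x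
      by (rule DERIV_minus[OF uminus(4)[OF that]])
  qed
  then show ?case by (simp add: normally_summable_def)
qed

section \<open>The terms of the Eulerian series\<close>

text \<open>
  The binomial coefficient \<open>x gchoose j\<close> as a polynomial in \<open>x\<close>, so that its derivatives are
  given by \<^const>\<open>pderiv\<close> and vanish above the degree.\<close>

definition gbinomial_poly :: "nat \<Rightarrow> real poly" where
  "gbinomial_poly j = smult (1 / fact j) (\<Prod>i<j. [:- real i, 1:])"

lemma poly_gbinomial_poly [simp]: "poly (gbinomial_poly j) x = x gchoose j"
  by (simp add: gbinomial_poly_def poly_prod gbinomial_prod_rev atLeast0LessThan)

lemma degree_gbinomial_poly [simp]: "degree (gbinomial_poly j) = j"
  by (simp add: gbinomial_poly_def degree_prod_eq_sum_degree)

lemma coeff_gbinomial_poly: "coeff (gbinomial_poly j) j = 1 / fact j"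
proof -
  have "degree (\<Prod>i<j. [:- real i, 1:]) = j" by (simp add: degree_prod_eq_sum_degree)
  moreover have "lead_coeff (\<Prod>i<j. [:- real i, 1:]) = 1" by (simp add: lead_coeff_prod)
  ultimately show ?thesis by (simp add: gbinomial_poly_def)
qed

lemma higher_pderiv_eq_0:
  fixes q :: "real poly"
  assumes "degree q < m"
  shows "(pderiv ^^ m) q = 0"
  using assms by (intro poly_eqI) (simp add: coeff_higher_pderiv coeff_eq_0)

lemma higher_pderiv_gbinomial_poly: "(pderiv ^^ j) (gbinomial_poly j) = 1"
proof (rule poly_eqI)
  fix n
  show "coeff ((pderiv ^^ j) (gbinomial_poly j)) n = coeff 1 n"
  proof (cases "n = 0")
    case True
    then show ?thesis
      by (simp add: coeff_higher_pderiv coeff_gbinomial_poly flip: pochhammer_fact)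
  next
    case False
    then show ?thesis by (simp add: coeff_higher_pderiv coeff_eq_0)
  qed
qed

definition eulerian_poly :: "nat \<Rightarrow> (real \<Rightarrow> real) \<Rightarrow> nat \<Rightarrow> real poly" where
  "eulerian_poly p g k = (\<Sum>j<p. smult ((fdiff ^^ j) g (real k)) (gbinomial_poly j))
     + smult ((deriv ^^ p) g (real k)) (gbinomial_poly p)"

text \<open>
  The \<open>m\<close>-th derivative of the \<open>k\<close>-th term of the series. A series in which \<open>k\<close> starts at \<open>1\<close> has terms that
  are differentiable on a neighbourhood of \<open>[0, \<infinity>)\<close>, although \<open>g\<close> is controlled on \<open>(0, \<infinity>)\<close> only.\<close>

definition eulerian_deriv :: "nat \<Rightarrow> (real \<Rightarrow> real) \<Rightarrow> nat \<Rightarrow> nat \<Rightarrow> real \<Rightarrow> real" where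
  "eulerian_deriv p g k m x =
     (deriv ^^ m) g (x + real k) - poly ((pderiv ^^ m) (eulerian_poly p g k)) x"

lemma eulerian_term_eq: "eulerian_term p g k = eulerian_deriv p g k 0"
  by (rule ext)
     (simp add: eulerian_term_def eulerian_deriv_def eulerian_poly_def poly_sum mult.commute)

lemma eulerian_deriv_tower:
  assumes "g \<in> C_class n"
  shows "derivative_tower n (eulerian_deriv p g k) {- real k<..}"
  unfolding derivative_tower_def
proof (intro allI impI ballI)
  fix m x assume m: "m < n" and x: "x \<in> {- real k<..}"
  have "((deriv ^^ m) g has_real_derivative (deriv ^^ Suc m) g (x + real k)) (at (x + real k))"
    by (rule derivative_towerD[OF C_class_tower[OF assms] m]) (use x in simp)
  then have "((\<lambda>x. (deriv ^^ m) g (x + real k)) has_real_derivative (deriv ^^ Suc m) g (x + real k)) (at x)"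
    by (simp only: DERIV_shift)
  then show "(eulerian_deriv p g k m has_real_derivative eulerian_deriv p g k (Suc m) x) (at x)"
    unfolding eulerian_deriv_def funpow.simps o_def
    by (intro DERIV_diff poly_DERIV)
qed

text \<open>
  The polynomial part is normalised so that its \<open>p\<close>-th derivative is the constant \<open>g\<^sup>(\<^sup>p\<^sup>)(k)\<close>. Thus the
  \<open>p\<close>-th derivative of a term is an increment of \<open>g\<^sup>(\<^sup>p\<^sup>)\<close>, to which \<open>normally_summable_increments\<close> applies.\<close>

lemma eulerian_deriv_degree:
  "eulerian_deriv p g k p x = (deriv ^^ p) g (x + real k) - (deriv ^^ p) g (real k)"
  by (simp add: eulerian_deriv_def eulerian_poly_def higher_pderiv_add higher_pderiv_sum
      higher_pderiv_smult higher_pderiv_gbinomial_poly higher_pderiv_eq_0 poly_sum)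

lemma eulerian_deriv_above_degree:
  "p < m \<Longrightarrow> eulerian_deriv p g k m x = (deriv ^^ m) g (x + real k)"
  by (simp add: eulerian_deriv_def eulerian_poly_def higher_pderiv_add higher_pderiv_sum
      higher_pderiv_smult higher_pderiv_eq_0 poly_sum)

text \<open>
  Each difference lowers the index of the binomial coefficients by one (Pascal's rule). For \<open>m < p\<close>
  and \<open>x = 0\<close> only the summand with \<open>j = 0\<close> survives, and it cancels against \<open>\<Delta>\<^sup>m g(k)\<close>: the
  polynomial part interpolates \<open>g (x + k)\<close> at \<open>x = 0, \<dots>, p - 1\<close>.\<close>

lemma fdiff_eulerian_term:
  assumes "m \<le> p"
  shows "(fdiff ^^ m) (eulerian_term p g k) x = (fdiff ^^ m) g (x + real k)
     - (\<Sum>j<p - m. (x gchoose j) * (fdiff ^^ (j + m)) g (real k))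
     - (x gchoose (p - m)) * (deriv ^^ p) g (real k)"
  using assms
proof (induction m arbitrary: x)
  case 0
  then show ?case by (simp add: eulerian_term_def)
next
  case (Suc m)
  define q where "q = p - Suc m"
  have q: "p - m = Suc q" "p - Suc m = q" using Suc.prems by (auto simp: q_def)
  let ?d = "\<lambda>j. (fdiff ^^ (j + m)) g (real k)"
  have "(\<Sum>j<Suc q. (x + 1 gchoose j) * ?d j) - (\<Sum>j<Suc q. (x gchoose j) * ?d j)
      = (\<Sum>j<q. (x gchoose j) * ?d (Suc j))"
    by (simp only: sum.lessThan_Suc_shift gbinomial_Suc_Suc distrib_right sum.distrib gbinomial_0(1))
  moreover have "(x + 1 gchoose Suc q) = (x gchoose q) + (x gchoose Suc q)"
    by (rule gbinomial_Suc_Suc)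
  ultimately show ?case
    using Suc.IH[of x] Suc.IH[of "x + 1"] Suc.prems
    by (simp add: fdiff_def[of "(fdiff ^^ m) _"] q algebra_simps)
qed

text \<open>
  The difference of order \<open>m\<close> of a term vanishes at \<open>0\<close>, and by the mean value theorem for
  differences it is a value of the \<open>m\<close>-th derivative.\<close>

lemma eulerian_deriv_zero:
  assumes "g \<in> C_class p" "m < p" "k > 0"
  shows "\<exists>\<xi>\<in>{0..real m}. eulerian_deriv p g k m \<xi> = 0"
proof -
  have "derivative_tower m (eulerian_deriv p g k) {0..0 + real m}"
    using eulerian_deriv_tower[OF assms(1), of p k] assms(2,3)
    unfolding derivative_tower_def by auto
  from fdiff_mvt[OF this] obtain \<xi> where \<xi>: "\<xi> \<in> {0..real m}"
    and eq: "(fdiff ^^ m) (eulerian_deriv p g k 0) 0 = eulerian_deriv p g k m \<xi>"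
    by auto
  have "(fdiff ^^ m) (eulerian_deriv p g k 0) 0 = 0"
  proof -
    obtain q where q: "p - m = Suc q" using assms(2) by (metis Suc_diff_Suc)
    have "(\<Sum>j<p - m. (0 gchoose j) * (fdiff ^^ (j + m)) g (real k)) = (fdiff ^^ m) g (real k)"
      unfolding q sum.lessThan_Suc_shift by simp
    then show ?thesis
      using fdiff_eulerian_term[of m p g k 0] assms(2) q by (simp add: eulerian_term_eq)
  qed
  with \<xi> eq show ?thesis by auto
qed

text \<open>
  Descending induction from \<open>m = p\<close>. Since the \<open>m\<close>-th derivative of a term has a zero in \<open>[0, p]\<close>, its size
  on \<open>[0, Y]\<close> with \<open>Y \<ge> p\<close> is at most \<open>Y\<close> times a bound for the next derivative.\<close>

lemma normally_summable_eulerian_deriv: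
  assumes "g \<in> C_class p" "eventually_monotone ((deriv ^^ p) g)" "((deriv ^^ p) g \<longlongrightarrow> 0) at_top"
    and "m \<le> p"
  shows "normally_summable (\<lambda>k. eulerian_deriv p g (Suc k) m)"
  using \<open>m \<le> p\<close>
proof (induction m rule: inc_induct)
  case base
  have "(\<lambda>k. eulerian_deriv p g (Suc k) p)
      = (\<lambda>k x. (deriv ^^ p) g (x + real (Suc k)) - (deriv ^^ p) g (real (Suc k)))"
    by (intro ext) (rule eulerian_deriv_degree)
  then show ?case using normally_summable_increments[OF assms(2,3)] by simp
next
  case (step m)
  show ?case unfolding normally_summable_def
  proof
    fix X :: real
    \<comment> \<open>The segment must contain the zeros of the derivatives, which lie in \<open>[0, p]\<close>.\<close>
    define Y where "Y = max X (real p)"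
    obtain M where M: "summable M"
      "\<forall>\<^sub>F k in sequentially. \<forall>x\<in>{0..Y}. \<bar>eulerian_deriv p g (Suc k) (Suc m) x\<bar> \<le> M k"
      using step.IH unfolding normally_summable_def by blast
    from M(2) have "\<forall>\<^sub>F k in sequentially. \<forall>x\<in>{0..X}. \<bar>eulerian_deriv p g (Suc k) m x\<bar> \<le> M k * Y"
    proof eventually_elim
      case (elim k)
      let ?E = "eulerian_deriv p g (Suc k)"
      obtain \<xi> where \<xi>: "\<xi> \<in> {0..real m}" "?E m \<xi> = 0"
        using eulerian_deriv_zero[OF assms(1), of m "Suc k"] step.hyps by auto
      have \<xi>Y: "\<xi> \<in> {0..Y}" using \<xi>(1) step.hyps by (auto simp: Y_def)
      have der: "(?E m has_real_derivative ?E (Suc m) y) (at y within {0..Y})" if "y \<in> {0..Y}" for y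
        by (rule has_field_derivative_at_within)
           (rule derivative_towerD[OF eulerian_deriv_tower[OF assms(1)]], use that step.hyps in auto)
      show ?case
      proof
        fix x assume "x \<in> {0..X}"
        then have xY: "x \<in> {0..Y}" by (auto simp: Y_def)
        have "norm (?E m x - ?E m \<xi>) \<le> M k * norm (x - \<xi>)"
          by (rule field_differentiable_bound[OF _ der _ xY \<xi>Y]) (use elim in auto)
        also have "\<dots> \<le> M k * Y"
        proof (rule mult_left_mono)
          show "norm (x - \<xi>) \<le> Y" using xY \<xi>Y by auto
          have "\<bar>?E (Suc m) x\<bar> \<le> M k" using elim xY by blast
          then show "0 \<le> M k" by linarith
        qed
        finally show "\<bar>?E m x\<bar> \<le> M k * Y" by (simp add: \<xi>(2))
      qed
    qed
    moreover have "summable (\<lambda>k. M k * Y)" using M(1) by (rule summable_mult2)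
    ultimately show "\<exists>M. summable M \<and>
        (\<forall>\<^sub>F k in sequentially. \<forall>x\<in>{0..X}. \<bar>eulerian_deriv p g (Suc k) m x\<bar> \<le> M k)" by blast
  qed
qed

lemma higher_deriv_eventually_monotone:
  assumes "g \<in> C_class n" "eventually_monotone ((deriv ^^ n) g)" "m \<le> n"
  shows "eventually_monotone ((deriv ^^ m) g)"
  using \<open>m \<le> n\<close>
proof (induction m rule: inc_induct)
  case base
  show ?case by (rule assms(2))
next
  case (step m)
  have "((deriv ^^ m) g has_real_derivative (deriv ^^ Suc m) g x) (at x)" if "x > 0" for x
    using derivative_towerD[OF C_class_tower[OF assms(1)] step.hyps(2)] that by simp
  then show ?case using step.IH by (rule eventually_monotone_antiderivative)
qed

lemma higher_deriv_tendsto_0: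
  assumes "g \<in> C_class n" "eventually_monotone ((deriv ^^ n) g)" "((deriv ^^ p) g \<longlongrightarrow> 0) at_top"
    and "p \<le> m" "m \<le> n"
  shows "((deriv ^^ m) g \<longlongrightarrow> 0) at_top"
  using \<open>p \<le> m\<close> \<open>m \<le> n\<close>
proof (induction m rule: dec_induct)
  case base
  show ?case by (rule assms(3))
next
  case (step m)
  have m: "m < n" using step.prems by simp
  have "((deriv ^^ m) g has_real_derivative (deriv ^^ Suc m) g x) (at x)" if "x > 0" for x
    using derivative_towerD[OF C_class_tower[OF assms(1)] m] that by simp
  moreover have "eventually_monotone ((deriv ^^ Suc m) g)"
    by (rule higher_deriv_eventually_monotone[OF assms(1,2) step.prems])
  moreover have "((deriv ^^ m) g \<longlongrightarrow> 0) at_top" using step.IH m by simp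
  ultimately show ?case by (rule eventually_monotone_derivative_tendsto_0)
qed

text \<open>
  Above order \<open>p\<close> the polynomial part is gone and the derivatives of the terms are translates of \<open>g\<^sup>(\<^sup>m\<^sup>)\<close>, which is the
  derivative of a function that is eventually monotone and tends to zero.\<close>

lemma normally_summable_eulerian_deriv_above:
  assumes "g \<in> C_class n" "eventually_monotone ((deriv ^^ n) g)" "((deriv ^^ p) g \<longlongrightarrow> 0) at_top"
    and "p < m" "m \<le> n"
  shows "normally_summable (\<lambda>k. eulerian_deriv p g (Suc k) m)"
proof -
  obtain l where l: "m = Suc l" "p \<le> l" "l < n" using assms(4,5) by (cases m) auto
  have "((deriv ^^ l) g has_real_derivative (deriv ^^ m) g x) (at x)" if "x > 0" for x
    using derivative_towerD[OF C_class_tower[OF assms(1)] l(3)] that l(1) by simp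
  moreover have "eventually_monotone ((deriv ^^ m) g)"
    by (rule higher_deriv_eventually_monotone[OF assms(1,2,5)])
  moreover have "((deriv ^^ m) g \<longlongrightarrow> 0) at_top"
    by (rule higher_deriv_tendsto_0[OF assms(1-3)]) (use assms in auto)
  moreover have "((deriv ^^ l) g \<longlongrightarrow> 0) at_top"
    by (rule higher_deriv_tendsto_0[OF assms(1-3)]) (use l in auto)
  ultimately have "normally_summable (\<lambda>k x. (deriv ^^ m) g (x + real (Suc k)))"
    by (intro normally_summable_translates_of_derivative)
  moreover have "(\<lambda>k. eulerian_deriv p g (Suc k) m) = (\<lambda>k x. (deriv ^^ m) g (x + real (Suc k)))"
    by (intro ext) (rule eulerian_deriv_above_degree[OF assms(4)])
  ultimately show ?thesis by simp
qed

section \<open>The defining limit of the principal indefinite sum\<close>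

text \<open>
  The values \<open>\<Delta>\<^sup>p g(n)\<close>, which tend to zero by assumption, are values of \<open>g\<^sup>(\<^sup>p\<^sup>)\<close> at points that tend to
  infinity, and \<open>g\<^sup>(\<^sup>p\<^sup>)\<close> is eventually monotone.\<close>

lemma degree_deriv_tendsto_0:
  assumes "g \<in> C_class p \<inter> D_class p \<inter> K_class p"
  shows "((deriv ^^ p) g \<longlongrightarrow> 0) at_top"
proof -
  have C: "g \<in> C_class p" and D: "g \<in> D_class p" and K: "g \<in> K_class p" using assms by auto
  have "\<exists>\<xi>\<ge>real (Suc n). (fdiff ^^ p) g (real (Suc n)) = (deriv ^^ p) g \<xi>" for n
  proof -
    have "derivative_tower p (\<lambda>m. (deriv ^^ m) g) {real (Suc n)..real (Suc n) + real p}"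
      using C_class_tower[OF C] unfolding derivative_tower_def by auto
    from fdiff_mvt[OF this] show ?thesis by auto
  qed
  then obtain \<xi> where \<xi>: "\<And>n. \<xi> n \<ge> real (Suc n)"
    "\<And>n. (fdiff ^^ p) g (real (Suc n)) = (deriv ^^ p) g (\<xi> n)"
    by metis
  have "(\<lambda>n. (fdiff ^^ p) g (real (Suc n))) \<longlonglongrightarrow> 0"
    using D LIMSEQ_Suc unfolding D_class_def by blast
  then have "(\<lambda>n. (deriv ^^ p) g (\<xi> n)) \<longlonglongrightarrow> 0" by (simp only: \<xi>(2))
  moreover have "filterlim \<xi> at_top sequentially"
  proof (rule filterlim_at_top_mono)
    show "filterlim (\<lambda>n. real (Suc n)) at_top sequentially"
      using filterlim_compose[OF filterlim_real_sequentially filterlim_Suc] .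
    show "\<forall>\<^sub>F n in sequentially. real (Suc n) \<le> \<xi> n"
      by (intro always_eventually allI \<xi>(1))
  qed
  ultimately show ?thesis
    using eventually_monotone_tendsto_0[OF K_class_imp_eventually_monotone[OF C K]] by blast
qed

lemma fdiff_tendsto_0:
  assumes "g \<in> C_class p" "((deriv ^^ p) g \<longlongrightarrow> 0) at_top"
  shows "((fdiff ^^ p) g \<longlongrightarrow> 0) at_top"
proof (rule tendstoI)
  fix e :: real assume "e > 0"
  then have "\<forall>\<^sub>F x in at_top. dist ((deriv ^^ p) g x) 0 < e"
    using assms(2) by (rule tendstoD[rotated])
  then obtain b where b: "\<And>x. x \<ge> b \<Longrightarrow> dist ((deriv ^^ p) g x) 0 < e"
    unfolding eventually_at_top_linorder by blast
  have "dist ((fdiff ^^ p) g x) 0 < e" if "x \<ge> max b 1" for x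
  proof -
    have "derivative_tower p (\<lambda>m. (deriv ^^ m) g) {x..x + real p}"
      using C_class_tower[OF assms(1)] that unfolding derivative_tower_def by auto
    from fdiff_mvt[OF this] obtain \<xi> where \<xi>: "\<xi> \<ge> x" "(fdiff ^^ p) g x = (deriv ^^ p) g \<xi>"
      by auto
    show ?thesis unfolding \<xi>(2) by (rule b) (use \<xi>(1) that in auto)
  qed
  then show "\<forall>\<^sub>F x in at_top. dist ((fdiff ^^ p) g x) 0 < e"
    unfolding eventually_at_top_linorder by blast
qed

text \<open>
  The asymptotic degree fixes the order that \<^const>\<open>prin_sum\<close> uses: a smaller
  order \<open>q\<close> would force \<open>\<Delta>\<^sup>q g\<close> to vanish at infinity along the reals.\<close>

lemma least_degree_eq:
  assumes g: "g \<in> C_class p \<inter> D_class p \<inter> K_class p" and deg: "asym_deg g = int p - 1"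
  shows "(LEAST q. g \<in> D_class q \<inter> K_class q) = p"
proof (rule Least_equality)
  show "g \<in> D_class p \<inter> K_class p" using g by blast
next
  fix q assume q: "g \<in> D_class q \<inter> K_class q"
  show "p \<le> q"
  proof (rule ccontr)
    assume "\<not> p \<le> q"
    then have "g \<in> C_class q" using g by (intro C_class_mono[of q p]) auto
    with q have "((fdiff ^^ q) g \<longlongrightarrow> 0) at_top"
      by (intro fdiff_tendsto_0 degree_deriv_tendsto_0) auto
    then have "(LEAST q. ((fdiff ^^ q) g \<longlongrightarrow> 0) at_top) \<le> q" by (rule Least_le)
    then show False using deg \<open>\<not> p \<le> q\<close> by (simp add: asym_deg_def)
  qed
qed

lemma sum_atLeast1_lessThan_Suc:
  fixes f :: "nat \<Rightarrow> real"
  shows "(\<Sum>k\<in>{1..<Suc N}. f k) = (\<Sum>k<N. f (Suc k))"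
  by (induction N) auto

lemma sum_atLeast1_atMost:
  fixes f :: "nat \<Rightarrow> real"
  shows "(\<Sum>k\<in>{1..N}. f k) = (\<Sum>k<N. f (Suc k))"
  by (induction N) auto

lemma prin_sum_seq_Suc:
  "prin_sum_seq p g x (Suc N) = - g x + (\<Sum>k<N. g (real (Suc k)) - g (x + real (Suc k)))
     + (\<Sum>j<p. (x gchoose Suc j) * (fdiff ^^ j) g (real (Suc N)))"
  unfolding prin_sum_seq_def sum_atLeast1_lessThan_Suc sum_atLeast1_atMost by simp

text \<open>
  The limit of \<open>\<Delta>\<^sup>p\<^sup>-\<^sup>1 g(n) - (\<Sum>k=1..n-1. g\<^sup>(\<^sup>p\<^sup>)(k))\<close>, written as a series. It turns out to be the
  \<open>p\<close>-th derivative of \<open>\<Sigma>g\<close> at \<open>1\<close>.\<close>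

definition eulerian_const :: "nat \<Rightarrow> (real \<Rightarrow> real) \<Rightarrow> real" where
  "eulerian_const p g = (fdiff ^^ (p - 1)) g 1
     + (\<Sum>k. (fdiff ^^ p) g (real (Suc k)) - (deriv ^^ p) g (real (Suc k)))"

text \<open>
  Writing each \<open>\<Delta>\<^sup>j g(n)\<close> as a telescoping sum from \<open>1\<close> turns the defining limit of \<open>\<Sigma>g\<close> into a
  series of Newton interpolation remainders. Replacing \<open>\<Delta>\<^sup>p g(k)\<close> by \<open>g\<^sup>(\<^sup>p\<^sup>)(k)\<close> in the top coefficient gives
  the terms of the Eulerian series, and the differences \<open>\<Delta>\<^sup>p g(k) - g\<^sup>(\<^sup>p\<^sup>)(k)\<close> are collected in
  the coefficient of \<open>x gchoose p\<close>.\<close>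

lemma prin_sum_seq_eulerian:
  assumes "p \<ge> 1"
  shows "prin_sum_seq p g x (Suc N) =
     (\<Sum>j\<in>{1..p - 1}. (x gchoose j) * (fdiff ^^ (j - 1)) g 1)
     + (x gchoose p) * ((fdiff ^^ (p - 1)) g 1
         + (\<Sum>k<N. (fdiff ^^ p) g (real (Suc k)) - (deriv ^^ p) g (real (Suc k))))
     - g x - (\<Sum>k<N. eulerian_term p g (Suc k) x)"
proof -
  obtain q where p: "p = Suc q" using assms by (cases p) auto
  show ?thesis
  proof (induction N)
    case 0
    show ?case unfolding prin_sum_seq_Suc sum_atLeast1_atMost by (simp add: p)
  next
    case (Suc N)
    let ?n = "real (Suc N)"
    have "(fdiff ^^ j) g (real (Suc (Suc N))) = (fdiff ^^ j) g ?n + (fdiff ^^ Suc j) g ?n" for j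
      by (simp add: fdiff_def[of "(fdiff ^^ j) g"] add_ac)
    then have "prin_sum_seq p g x (Suc (Suc N)) - prin_sum_seq p g x (Suc N)
        = g ?n - g (x + ?n) + (\<Sum>j<p. (x gchoose Suc j) * (fdiff ^^ Suc j) g ?n)"
      unfolding prin_sum_seq_Suc by (simp only: sum.lessThan_Suc distrib_left sum.distrib)
    moreover have "g ?n + (\<Sum>j<p. (x gchoose Suc j) * (fdiff ^^ Suc j) g ?n)
        = (\<Sum>j<Suc p. (x gchoose j) * (fdiff ^^ j) g ?n)"
      unfolding sum.lessThan_Suc_shift by simp
    ultimately show ?case using Suc by (simp add: eulerian_term_def algebra_simps)
  qed
qed

lemma prin_sum_seq_step:
  assumes "p \<ge> 1"
  shows "prin_sum_seq p g (x + 1) (Suc N) - prin_sum_seq p g x (Suc N)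
     = g x - eulerian_term p g (Suc N) x - (x gchoose p) * (deriv ^^ p) g (real (Suc N))"
proof -
  have "(\<Sum>k<N. g (real (Suc k)) - g (x + 1 + real (Suc k)))
      - (\<Sum>k<N. g (real (Suc k)) - g (x + real (Suc k))) = g (x + 1) - g (x + real (Suc N))"
    by (induction N) (simp_all add: add_ac)
  moreover have "(\<Sum>j<p. (x + 1 gchoose Suc j) * (fdiff ^^ j) g (real (Suc N)))
      - (\<Sum>j<p. (x gchoose Suc j) * (fdiff ^^ j) g (real (Suc N)))
      = (\<Sum>j<p. (x gchoose j) * (fdiff ^^ j) g (real (Suc N)))"
    by (simp only: gbinomial_Suc_Suc distrib_right sum.distrib)
  ultimately show ?thesis unfolding prin_sum_seq_Suc eulerian_term_def by simp
qed

section \<open>Repeated integration term by term\<close>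

definition oriented_integral :: "real \<Rightarrow> (real \<Rightarrow> real) \<Rightarrow> real \<Rightarrow> real" where
  "oriented_integral c f x = integral {c..x} f - integral {x..c} f"

text \<open>
  On a segment that starts at \<open>0\<close> the oriented integral is a difference of two ordinary ones, which
  is linear in \<open>f\<close> and continuous in \<open>x\<close>.\<close>

lemma oriented_integral_eq:
  assumes "continuous_on {0..X} f" "c \<in> {0..X}" "x \<in> {0..X}"
  shows "oriented_integral c f x = integral {0..x} f - integral {0..c} f"
proof -
  have int: "f integrable_on {0..y}" if "y \<le> X" for y
    by (rule integrable_continuous_real[OF continuous_on_subset[OF assms(1)]]) (use that in auto)
  show ?thesis
  proof (cases "c \<le> x")
    case True
    then have "integral {x..c} f = 0" by (cases "c = x") simp_all
    then show ?thesis
      using Henstock_Kurzweil_Integration.integral_combine[of 0 c x f] True assms int[of x]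
      by (simp add: oriented_integral_def)
  next
    case False
    then have "integral {c..x} f = 0" by simp
    then show ?thesis
      using Henstock_Kurzweil_Integration.integral_combine[of 0 x c f] False assms int[of c]
      by (simp add: oriented_integral_def)
  qed
qed

lemma oriented_integral_bound:
  assumes "continuous_on {0..X} f" "c \<in> {0..X}" "x \<in> {0..X}" "B \<ge> 0"
    and "\<And>t. t \<in> {0..X} \<Longrightarrow> \<bar>f t\<bar> \<le> B"
  shows "\<bar>oriented_integral c f x\<bar> \<le> B * X"
proof -
  have bd: "\<bar>integral {u..v} f\<bar> \<le> B * X" if "u \<le> v" "u \<in> {0..X}" "v \<in> {0..X}" for u v
  proof -
    have "norm (integral {u..v} f) \<le> B * (v - u)"
      by (rule integral_bound[OF that(1) continuous_on_subset[OF assms(1)]])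
         (use that assms(5) in auto)
    also have "\<dots> \<le> B * X" using that assms(4) by (intro mult_left_mono) auto
    finally show ?thesis by simp
  qed
  show ?thesis
  proof (cases "c \<le> x")
    case True
    then have "integral {x..c} f = 0" by (cases "c = x") simp_all
    then show ?thesis using bd[OF True assms(2,3)] by (simp add: oriented_integral_def)
  next
    case False
    then have "integral {c..x} f = 0" by simp
    then show ?thesis using bd[OF _ assms(3,2)] False by (simp add: oriented_integral_def)
  qed
qed

lemma rep_integral_Cons: "rep_integral (c # cs) f = rep_integral cs (oriented_integral c f)"
  by (simp add: oriented_integral_def[abs_def])

lemma rep_integral_continuous_on:
  assumes "continuous_on {0..X} f" "set cs \<subseteq> {0..X}"
  shows "continuous_on {0..X} (rep_integral cs f)"
  using assms
proof (induction cs arbitrary: f)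
  case Nil
  then show ?case by simp
next
  case (Cons c cs)
  have "continuous_on {0..X} (\<lambda>x. integral {0..x} f - integral {0..c} f)"
    by (intro continuous_intros indefinite_integral_continuous_1
        integrable_continuous_real Cons.prems(1))
  then have "continuous_on {0..X} (oriented_integral c f)"
    by (rule continuous_on_eq) (rule oriented_integral_eq[symmetric], use Cons.prems in auto)
  then show ?case unfolding rep_integral_Cons using Cons.prems by (intro Cons.IH) auto
qed

text \<open>
  Induction over the base points. Integrating the error \<open>\<Sum>k<n. u k - U\<close> over a part of \<open>[0, X]\<close> enlarges
  its supremum at most by the factor \<open>X\<close>, so uniform convergence survives each integration. The limit \<open>U\<close>
  has to be arbitrary, because after one step it is an integral and no longer literally a series.\<close>

lemma rep_integral_uniform_limit:
  assumes "\<And>k. continuous_on {0..X} (u k)"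
    and "uniform_limit {0..X} (\<lambda>n x. \<Sum>k<n. u k x) U sequentially"
    and "set cs \<subseteq> {0..X}"
  shows "uniform_limit {0..X} (\<lambda>n x. \<Sum>k<n. rep_integral cs (u k) x) (rep_integral cs U) sequentially"
  using assms
proof (induction cs arbitrary: u U)
  case Nil
  then show ?case by simp
next
  case (Cons c cs)
  note cont = Cons.prems(1) and lim = Cons.prems(2)
  have c: "c \<in> {0..X}" and cs: "set cs \<subseteq> {0..X}" using Cons.prems(3) by auto
  have contU: "continuous_on {0..X} U"
    by (rule uniform_limit_theorem[OF _ lim])
       (auto intro!: always_eventually continuous_on_sum cont)
  have intU: "U integrable_on {0..x}" and intu: "u k integrable_on {0..x}" if "x \<in> {0..X}" for x k
    using that by (auto intro!: integrable_continuous_real intro: continuous_on_subset[OF contU]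
        continuous_on_subset[OF cont])
  have "uniform_limit {0..X} (\<lambda>n x. \<Sum>k<n. oriented_integral c (u k) x) (oriented_integral c U) sequentially"
  proof (rule uniform_limitI)
    fix e :: real assume "e > 0"
    have X: "X \<ge> 0" using c by auto
    \<comment> \<open>\<open>X + 1\<close> instead of \<open>X\<close>, since \<open>X\<close> may be zero.\<close>
    define d where "d = e / (X + 1)"
    have d: "d > 0" "d * X < e" using \<open>e > 0\<close> X by (simp_all add: d_def field_simps)
    have "\<forall>\<^sub>F n in sequentially. \<forall>t\<in>{0..X}. dist (\<Sum>k<n. u k t) (U t) < d"
      using uniform_limitD[OF lim d(1)] .
    then show "\<forall>\<^sub>F n in sequentially. \<forall>x\<in>{0..X}.
        dist (\<Sum>k<n. oriented_integral c (u k) x) (oriented_integral c U x) < e"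
    proof eventually_elim
      case (elim n)
      let ?W = "\<lambda>t. (\<Sum>k<n. u k t) - U t"
      have contW: "continuous_on {0..X} ?W" by (intro continuous_intros cont contU)
      show ?case
      proof
        fix x assume x: "x \<in> {0..X}"
        have lin: "integral {0..y} ?W = (\<Sum>k<n. integral {0..y} (u k)) - integral {0..y} U"
          if "y \<in> {0..X}" for y
          using intu[OF that] intU[OF that]
          by (subst integral_diff) (auto intro!: integrable_sum simp: integral_sum)
        have "oriented_integral c ?W x = (\<Sum>k<n. oriented_integral c (u k) x) - oriented_integral c U x"
          by (simp add: oriented_integral_eq[OF contW c x] oriented_integral_eq[OF cont c x]
              oriented_integral_eq[OF contU c x] lin[OF x] lin[OF c] sum_subtractf)
        moreover have "\<bar>oriented_integral c ?W x\<bar> \<le> d * X"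
          by (rule oriented_integral_bound[OF contW c x])
             (use d elim in \<open>auto simp: dist_real_def intro: less_imp_le\<close>)
        ultimately show "dist (\<Sum>k<n. oriented_integral c (u k) x) (oriented_integral c U x) < e"
          using d by (simp add: dist_real_def)
      qed
    qed
  qed
  moreover have "continuous_on {0..X} (oriented_integral c (u k))" for k
    using rep_integral_continuous_on[OF cont, of "[c]" k] c by (simp add: rep_integral_Cons del: rep_integral.simps(2))
  ultimately show ?case unfolding rep_integral_Cons using cs by (intro Cons.IH)
qed

lemma termwise_integrable_on_normally_summable:
  assumes "normally_summable u" "\<And>k. continuous_on {0..} (u k)" "bounded I" "I \<subseteq> {0..}"
  shows "termwise_integrable_on u I"
proof -
  obtain X where "\<And>x. x \<in> I \<Longrightarrow> \<bar>x\<bar> \<le> X" using assms(3) by (auto simp: bounded_iff)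
  then have I: "I \<subseteq> {0..X}" using assms(4) by force
  have cont: "continuous_on {0..X} (u k)" for k
    by (rule continuous_on_subset[OF assms(2)]) auto
  have contU: "continuous_on {0..X} (\<lambda>x. \<Sum>k. u k x)"
    by (rule continuous_on_subset[OF normally_summable_continuous_on[OF assms(1,2)]]) auto
  have lim: "uniform_limit {0..X} (\<lambda>n x. \<Sum>k<n. u k x) (\<lambda>x. \<Sum>k. u k x) sequentially"
    by (rule normally_summable_uniform_limit[OF assms(1)]) auto
  have int: "rep_integral cs f integrable_on {a..b}"
    if "continuous_on {0..X} f" "set cs \<subseteq> I" "a \<in> I" "b \<in> I" for cs f a b
  proof (rule integrable_continuous_real[OF continuous_on_subset])
    show "continuous_on {0..X} (rep_integral cs f)"
      by (rule rep_integral_continuous_on[OF that(1)]) (use that(2) I in auto)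
    show "{a..b} \<subseteq> {0..X}" using that I by auto
  qed
  have "(\<lambda>k. rep_integral cs (u k) x) sums rep_integral cs (\<lambda>x. \<Sum>k. u k x) x"
    if "set cs \<subseteq> I" "x \<in> I" for cs x
  proof -
    have "set cs \<subseteq> {0..X}" "x \<in> {0..X}" using that I by auto
    from tendsto_uniform_limitI[OF rep_integral_uniform_limit[OF cont lim this(1)] this(2)]
    show ?thesis unfolding sums_def .
  qed
  then show ?thesis
    unfolding termwise_integrable_on_def using int[OF cont] int[OF contU] by blast
qed

section \<open>Derivatives of the principal indefinite sum\<close>

text \<open>
  The formal \<open>m\<close>-th derivative of the right-hand side of the series representation of \<open>\<Sigma>g\<close>, with
  \<^const>\<open>eulerian_const\<close> as the coefficient of \<open>x gchoose p\<close>.\<close>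

definition prin_sum_deriv :: "nat \<Rightarrow> (real \<Rightarrow> real) \<Rightarrow> nat \<Rightarrow> real \<Rightarrow> real" where
  "prin_sum_deriv p g m x =
     poly ((pderiv ^^ m) ((\<Sum>j\<in>{1..p - 1}. smult ((fdiff ^^ (j - 1)) g 1) (gbinomial_poly j))
       + smult (eulerian_const p g) (gbinomial_poly p))) x
     - (deriv ^^ m) g x - (\<Sum>k. eulerian_deriv p g (Suc k) m x)"

lemma prin_sum_deriv_0:
  "prin_sum_deriv p g 0 x = (\<Sum>j\<in>{1..p - 1}. (x gchoose j) * (fdiff ^^ (j - 1)) g 1)
     + (x gchoose p) * eulerian_const p g - g x - (\<Sum>k. eulerian_term p g (Suc k) x)"
  by (simp add: prin_sum_deriv_def eulerian_term_eq poly_sum mult.commute)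

lemma eulerian_deriv_continuous_on:
  assumes "g \<in> C_class n"
  shows "continuous_on {0..} (eulerian_deriv p g (Suc k) n)"
proof -
  have "continuous_on {0..} (\<lambda>x. (deriv ^^ n) g (x + real (Suc k)))"
    by (rule continuous_on_compose2[OF C_class_continuous_higher_deriv[OF assms order_refl]])
       (auto intro!: continuous_intros)
  then show ?thesis unfolding eulerian_deriv_def by (intro continuous_intros)
qed

lemma eulerian_deriv_has_derivative:
  assumes "g \<in> C_class n" "m < n" "x \<ge> 0"
  shows "(eulerian_deriv p g (Suc k) m has_real_derivative eulerian_deriv p g (Suc k) (Suc m) x) (at x)"
  by (rule derivative_towerD[OF eulerian_deriv_tower[OF assms(1)] assms(2)]) (use assms(3) in simp)

lemma prin_sum_deriv_tower:
  assumes C: "g \<in> C_class n"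
    and norm: "\<And>m. m \<le> n \<Longrightarrow> normally_summable (\<lambda>k. eulerian_deriv p g (Suc k) m)"
  shows "derivative_tower n (prin_sum_deriv p g) {0<..}"
  unfolding derivative_tower_def
proof (intro allI impI ballI)
  fix m x assume m: "m < n" and x: "x \<in> {0::real<..}"
  have "((\<lambda>x. \<Sum>k. eulerian_deriv p g (Suc k) m x) has_real_derivative
      (\<Sum>k. eulerian_deriv p g (Suc k) (Suc m) x)) (at x within {0..})"
    by (rule normally_summable_has_derivative[OF norm norm eulerian_deriv_has_derivative[OF C]])
       (use m x in auto)
  moreover have "at x within {0..} = at x"
  proof (rule at_within_nhd)
    show "{0..} \<inter> {0<..} - {x} = UNIV \<inter> {0<..} - {x}" by auto
  qed (use x in auto)
  ultimately have "((\<lambda>x. \<Sum>k. eulerian_deriv p g (Suc k) m x) has_real_derivative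
      (\<Sum>k. eulerian_deriv p g (Suc k) (Suc m) x)) (at x)" by simp
  moreover have "((deriv ^^ m) g has_real_derivative (deriv ^^ Suc m) g x) (at x)"
    using derivative_towerD[OF C_class_tower[OF C] m x] .
  ultimately show "(prin_sum_deriv p g m has_real_derivative prin_sum_deriv p g (Suc m) x) (at x)"
    unfolding prin_sum_deriv_def funpow.simps o_def by (intro DERIV_diff poly_DERIV)
qed

lemma prin_sum_deriv_continuous_on:
  assumes C: "g \<in> C_class n"
    and norm: "normally_summable (\<lambda>k. eulerian_deriv p g (Suc k) n)"
  shows "continuous_on {0<..} (prin_sum_deriv p g n)"
proof -
  have "continuous_on {0..} (\<lambda>x. \<Sum>k. eulerian_deriv p g (Suc k) n x)"
    by (rule normally_summable_continuous_on[OF norm eulerian_deriv_continuous_on[OF C]])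
  then have "continuous_on {0<..} (\<lambda>x. \<Sum>k. eulerian_deriv p g (Suc k) n x)"
    by (rule continuous_on_subset) auto
  then show ?thesis unfolding prin_sum_deriv_def
    by (intro continuous_intros C_class_continuous_higher_deriv[OF C order_refl])
qed

lemma prin_sum_deriv_degree:
  "prin_sum_deriv p g p x = eulerian_const p g - (deriv ^^ p) g x
     - (\<Sum>k. (deriv ^^ p) g (x + real (Suc k)) - (deriv ^^ p) g (real (Suc k)))"
proof -
  have "(\<Sum>j\<in>{1..p - 1}. (pderiv ^^ p) (smult ((fdiff ^^ (j - 1)) g 1) (gbinomial_poly j))) = 0"
    by (intro sum.neutral) (auto simp: higher_pderiv_smult higher_pderiv_eq_0)
  then show ?thesis
    unfolding prin_sum_deriv_def higher_pderiv_add higher_pderiv_sum higher_pderiv_smult[of p "eulerian_const p g"]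
    by (simp add: higher_pderiv_gbinomial_poly eulerian_deriv_degree)
qed

text \<open>
  At \<open>x = 1\<close> the series of increments telescopes to \<open>- g\<^sup>(\<^sup>p\<^sup>)(1)\<close>, so that everything but the constant
  cancels.\<close>

lemma prin_sum_deriv_degree_1:
  assumes "((deriv ^^ p) g \<longlongrightarrow> 0) at_top"
  shows "prin_sum_deriv p g p 1 = eulerian_const p g"
proof -
  let ?f = "\<lambda>k. (deriv ^^ p) g (real (k + 1))"
  have "?f \<longlonglongrightarrow> 0"
    by (intro filterlim_compose[OF assms]
        filterlim_compose[OF filterlim_real_sequentially filterlim_add_const_nat_at_top])
  then have "(\<lambda>k. ?f (Suc k) - ?f k) sums (0 - ?f 0)" by (rule telescope_sums)
  then have "(\<Sum>k. (deriv ^^ p) g (1 + real (Suc k)) - (deriv ^^ p) g (real (Suc k)))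
      = - (deriv ^^ p) g 1"
    by (simp add: sums_iff add_ac)
  then show ?thesis unfolding prin_sum_deriv_degree by simp
qed

text \<open>
  \<open>\<Delta>\<^sup>p g(k)\<close> is a value of \<open>g\<^sup>(\<^sup>p\<^sup>)\<close> in \<open>[k, k + p]\<close>, so the summand is again an increment of
  \<open>g\<^sup>(\<^sup>p\<^sup>)\<close> over a bounded distance.\<close>

lemma summable_eulerian_const:
  assumes "g \<in> C_class p" "eventually_monotone ((deriv ^^ p) g)" "((deriv ^^ p) g \<longlongrightarrow> 0) at_top"
  shows "summable (\<lambda>k. (fdiff ^^ p) g (real (Suc k)) - (deriv ^^ p) g (real (Suc k)))"
proof -
  let ?G = "(deriv ^^ p) g"
  obtain M where M: "summable M"
    "\<forall>\<^sub>F k in sequentially. \<forall>x\<in>{0..real p}. \<bar>?G (x + real (Suc k)) - ?G (real (Suc k))\<bar> \<le> M k"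
    using normally_summable_increments[OF assms(2,3)] unfolding normally_summable_def by blast
  from M(2) have "\<forall>\<^sub>F k in sequentially. norm ((fdiff ^^ p) g (real (Suc k)) - ?G (real (Suc k))) \<le> M k"
  proof eventually_elim
    case (elim k)
    have "derivative_tower p (\<lambda>m. (deriv ^^ m) g) {real (Suc k)..real (Suc k) + real p}"
      using C_class_tower[OF assms(1)] unfolding derivative_tower_def by auto
    from fdiff_mvt[OF this] obtain \<xi> where
      \<xi>: "\<xi> \<in> {real (Suc k)..real (Suc k) + real p}" "(fdiff ^^ p) g (real (Suc k)) = ?G \<xi>"
      by auto
    have "\<bar>?G ((\<xi> - real (Suc k)) + real (Suc k)) - ?G (real (Suc k))\<bar> \<le> M k"
      using elim \<xi>(1) by (intro bspec[OF elim]) auto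
    then show ?case using \<xi>(2) by simp
  qed
  then show ?thesis using M(1) by (rule summable_comparison_test_ev)
qed

lemma prin_sum_eq:
  assumes g: "g \<in> C_class p \<inter> D_class p \<inter> K_class p" and "p \<ge> 1" and deg: "asym_deg g = int p - 1"
    and "x \<ge> 0"
  shows "prin_sum g x = prin_sum_deriv p g 0 x" "(\<lambda>N. prin_sum_seq p g x (Suc N)) \<longlonglongrightarrow> prin_sum g x"
proof -
  have C: "g \<in> C_class p" and em: "eventually_monotone ((deriv ^^ p) g)"
    using g K_class_imp_eventually_monotone by auto
  note lim = degree_deriv_tendsto_0[OF g]
  have "normally_summable (\<lambda>k. eulerian_term p g (Suc k))"
    unfolding eulerian_term_eq by (rule normally_summable_eulerian_deriv[OF C em lim]) simp
  then have "summable (\<lambda>k. eulerian_term p g (Suc k) x)"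
    using \<open>x \<ge> 0\<close> by (rule normally_summable_imp_summable)
  then have "(\<lambda>N. prin_sum_seq p g x (Suc N)) \<longlonglongrightarrow> prin_sum_deriv p g 0 x"
    unfolding prin_sum_seq_eulerian[OF \<open>p \<ge> 1\<close>] prin_sum_deriv_0 eulerian_const_def
    by (intro tendsto_intros summable_LIMSEQ summable_eulerian_const[OF C em lim])
  moreover from this have "prin_sum_seq p g x \<longlonglongrightarrow> prin_sum_deriv p g 0 x"
    by (rule LIMSEQ_imp_Suc)
  then have "prin_sum g x = prin_sum_deriv p g 0 x"
    unfolding prin_sum_def least_degree_eq[OF g deg] by (rule limI)
  ultimately show "prin_sum g x = prin_sum_deriv p g 0 x"
    "(\<lambda>N. prin_sum_seq p g x (Suc N)) \<longlonglongrightarrow> prin_sum g x" by simp_all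
qed

text \<open>
  The error in the difference equation for the approximants is
  an Eulerian term plus a multiple of \<open>g\<^sup>(\<^sup>p\<^sup>)(n)\<close>; both tend to zero.\<close>

lemma prin_sum_difference:
  assumes g: "g \<in> C_class p \<inter> D_class p \<inter> K_class p" and "p \<ge> 1" and deg: "asym_deg g = int p - 1"
    and "x \<ge> 0"
  shows "prin_sum g (x + 1) - prin_sum g x = g x"
proof -
  have C: "g \<in> C_class p" and em: "eventually_monotone ((deriv ^^ p) g)"
    using g K_class_imp_eventually_monotone by auto
  note lim = degree_deriv_tendsto_0[OF g]
  have "normally_summable (\<lambda>k. eulerian_term p g (Suc k))"
    unfolding eulerian_term_eq by (rule normally_summable_eulerian_deriv[OF C em lim]) simp
  then have "(\<lambda>N. eulerian_term p g (Suc N) x) \<longlonglongrightarrow> 0"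
    using \<open>x \<ge> 0\<close> by (intro summable_LIMSEQ_zero normally_summable_imp_summable)
  moreover have "(\<lambda>N. (deriv ^^ p) g (real (N + 1))) \<longlonglongrightarrow> 0"
    by (intro filterlim_compose[OF lim]
        filterlim_compose[OF filterlim_real_sequentially filterlim_add_const_nat_at_top])
  then have "(\<lambda>N. (deriv ^^ p) g (real (Suc N))) \<longlonglongrightarrow> 0" by simp
  ultimately have "(\<lambda>N. g x - eulerian_term p g (Suc N) x - (x gchoose p) * (deriv ^^ p) g (real (Suc N)))
      \<longlonglongrightarrow> g x - 0 - (x gchoose p) * 0"
    by (intro tendsto_intros)
  then have "(\<lambda>N. prin_sum_seq p g (x + 1) (Suc N) - prin_sum_seq p g x (Suc N)) \<longlonglongrightarrow> g x"
    unfolding prin_sum_seq_step[OF \<open>p \<ge> 1\<close>] by simp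
  moreover have "(\<lambda>N. prin_sum_seq p g (x + 1) (Suc N) - prin_sum_seq p g x (Suc N))
      \<longlonglongrightarrow> prin_sum g (x + 1) - prin_sum g x"
    using \<open>x \<ge> 0\<close> by (intro tendsto_diff prin_sum_eq(2)[OF assms(1-3)]) auto
  ultimately show ?thesis by (rule LIMSEQ_unique[rotated])
qed

lemma deriv_in_D0_K0:
  assumes "g \<in> C_class p \<inter> D_class p \<inter> K_class p"
  shows "(deriv ^^ p) g \<in> D_class 0 \<inter> K_class 0"
proof
  have "(\<lambda>n. (deriv ^^ p) g (real n)) \<longlonglongrightarrow> 0"
    by (rule filterlim_compose[OF degree_deriv_tendsto_0[OF assms] filterlim_real_sequentially])
  then show "(deriv ^^ p) g \<in> D_class 0" by (simp add: D_class_def)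
  show "(deriv ^^ p) g \<in> K_class 0"
    using assms by (intro eventually_monotone_imp_K_class_0 K_class_imp_eventually_monotone) auto
qed

text \<open>
  Of degree \<open>0\<close>, the defining limit of \<open>\<Sigma>(g\<^sup>(\<^sup>p\<^sup>))\<close> is exactly the series that appears in the \<open>p\<close>-th
  derivative of \<open>\<Sigma>g\<close>.\<close>

lemma prin_sum_of_deriv:
  assumes g: "g \<in> C_class p \<inter> D_class p \<inter> K_class p" and "x \<ge> 0"
  shows "prin_sum ((deriv ^^ p) g) x = prin_sum_deriv p g p x - eulerian_const p g"
proof -
  let ?G = "(deriv ^^ p) g"
  have C: "g \<in> C_class p" and em: "eventually_monotone ?G"
    using g K_class_imp_eventually_monotone by auto
  note lim = degree_deriv_tendsto_0[OF g]
  have least: "(LEAST q. ?G \<in> D_class q \<inter> K_class q) = 0"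
    using deriv_in_D0_K0[OF g] by (rule Least_eq_0)
  have "summable (\<lambda>k. ?G (x + real (Suc k)) - ?G (real (Suc k)))"
    using normally_summable_imp_summable[OF normally_summable_increments[OF em lim] \<open>x \<ge> 0\<close>] .
  then have "(\<lambda>N. - ?G x - (\<Sum>k<N. ?G (x + real (Suc k)) - ?G (real (Suc k))))
      \<longlonglongrightarrow> - ?G x - (\<Sum>k. ?G (x + real (Suc k)) - ?G (real (Suc k)))"
    by (intro tendsto_intros summable_LIMSEQ)
  moreover have "prin_sum_seq 0 ?G x (Suc N)
      = - ?G x - (\<Sum>k<N. ?G (x + real (Suc k)) - ?G (real (Suc k)))" for N
    unfolding prin_sum_seq_Suc by (simp add: sum_subtractf)
  ultimately have "(\<lambda>N. prin_sum_seq 0 ?G x (Suc N))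
      \<longlonglongrightarrow> - ?G x - (\<Sum>k. ?G (x + real (Suc k)) - ?G (real (Suc k)))"
    by (simp only:)
  then have "prin_sum_seq 0 ?G x
      \<longlonglongrightarrow> - ?G x - (\<Sum>k. ?G (x + real (Suc k)) - ?G (real (Suc k)))"
    by (rule LIMSEQ_imp_Suc)
  then show ?thesis
    unfolding prin_sum_def least prin_sum_deriv_degree by (simp add: limI)
qed

text \<open>
  By \<open>prin_sum_of_deriv\<close>, \<open>(\<Sigma>g)\<^sup>(\<^sup>p\<^sup>-\<^sup>1\<^sup>)(t) - c t\<close> with \<open>c\<close> the \<^const>\<open>eulerian_const\<close> is an
  antiderivative of \<open>\<Sigma>(g\<^sup>(\<^sup>p\<^sup>))\<close>. Its increment over \<open>[1, 2]\<close> is \<open>g\<^sup>(\<^sup>p\<^sup>-\<^sup>1\<^sup>)(1) - c\<close>, because the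
  difference equation \<open>\<Delta>\<Sigma>g = g\<close> can be differentiated \<open>p - 1\<close> times. Since \<open>g\<^sup>(\<^sup>p\<^sup>)\<close> has asymptotic degree
  \<open>-1\<close>, its generalized Euler constant is the integral of \<open>\<Sigma>(g\<^sup>(\<^sup>p\<^sup>))\<close> over \<open>[1, 2]\<close> minus
  \<open>\<Sigma>(g\<^sup>(\<^sup>p\<^sup>))(1) = 0\<close>.\<close>

lemma asym_const_of_deriv:
  assumes g: "g \<in> C_class p \<inter> D_class p \<inter> K_class p" and p: "p \<ge> 1" and deg: "asym_deg g = int p - 1"
  shows "asym_const ((deriv ^^ p) g) = (deriv ^^ (p - 1)) g 1 - eulerian_const p g"
    and "gen_euler_const ((deriv ^^ p) g) = asym_const ((deriv ^^ p) g)"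
proof -
  let ?G = "(deriv ^^ p) g" and ?c = "eulerian_const p g" and ?S = "prin_sum_deriv p g"
  have C: "g \<in> C_class p" and em: "eventually_monotone ?G"
    using g K_class_imp_eventually_monotone by auto
  note lim = degree_deriv_tendsto_0[OF g]
  have tower: "derivative_tower p ?S {0<..}"
    by (rule prin_sum_deriv_tower[OF C normally_summable_eulerian_deriv[OF C em lim]])
  have der: "((\<lambda>t. ?S (p - 1) t - ?c * t) has_real_derivative prin_sum ?G t) (at t)" if "t > 0" for t
  proof -
    have "(?S (p - 1) has_real_derivative ?S (Suc (p - 1)) t) (at t)"
      by (rule derivative_towerD[OF tower]) (use p that in auto)
    then have "(?S (p - 1) has_real_derivative ?S p t) (at t)" using p by simp
    from DERIV_diff[OF this DERIV_cmult_Id[of ?c]] show ?thesis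
      using that by (simp add: prin_sum_of_deriv[OF g])
  qed
  have shifted: "?S (p - 1) 2 - ?S (p - 1) 1 = (deriv ^^ (p - 1)) g 1"
  proof -
    have "derivative_tower p (\<lambda>m x. ?S m (x + 1) - ?S m x) {0<..}"
      unfolding derivative_tower_def
    proof (intro allI impI ballI)
      fix m x assume m: "m < p" and x: "x \<in> {0::real<..}"
      have "(?S m has_real_derivative ?S (Suc m) (x + 1)) (at (x + 1))"
        "(?S m has_real_derivative ?S (Suc m) x) (at x)"
        by (rule derivative_towerD[OF tower m], use x in simp)+
      then show "((\<lambda>x. ?S m (x + 1) - ?S m x) has_real_derivative ?S (Suc m) (x + 1) - ?S (Suc m) x) (at x)"
        by (intro DERIV_diff) (simp_all only: DERIV_shift)
    qed
    then have "(deriv ^^ (p - 1)) g 1 = ?S (p - 1) (1 + 1) - ?S (p - 1) 1"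
      by (rule higher_deriv_eq_tower[OF open_greaterThan])
         (use prin_sum_difference[OF g p deg] prin_sum_eq(1)[OF g p deg] in auto)
    then show ?thesis by simp
  qed
  have "((\<lambda>t. prin_sum ?G (t + 1)) has_integral
      (?S (p - 1) (1 + 1) - ?c * (1 + 1)) - (?S (p - 1) (0 + 1) - ?c * (0 + 1))) {0..1}"
  proof (rule fundamental_theorem_of_calculus)
    fix t :: real assume "t \<in> {0..1}"
    then have "((\<lambda>t. ?S (p - 1) (t + 1) - ?c * (t + 1)) has_real_derivative prin_sum ?G (t + 1)) (at t)"
      using der[of "t + 1"] by (simp only: DERIV_shift) simp
    then show "((\<lambda>t. ?S (p - 1) (t + 1) - ?c * (t + 1)) has_vector_derivative prin_sum ?G (t + 1))
        (at t within {0..1})"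
      by (simp add: has_real_derivative_iff_has_vector_derivative has_vector_derivative_at_within)
  qed simp
  then show ac: "asym_const ?G = (deriv ^^ (p - 1)) g 1 - ?c"
    using shifted by (simp add: asym_const_def integral_unique)
  have "(prin_sum ?G has_integral (?S (p - 1) 2 - ?c * 2) - (?S (p - 1) 1 - ?c * 1)) {1..2}"
  proof (rule fundamental_theorem_of_calculus)
    fix t :: real assume "t \<in> {1..2}"
    then show "((\<lambda>t. ?S (p - 1) t - ?c * t) has_vector_derivative prin_sum ?G t) (at t within {1..2})"
      using der[of t]
      by (simp add: has_real_derivative_iff_has_vector_derivative has_vector_derivative_at_within)
  qed simp
  then have int: "integral {1..2} (prin_sum ?G) = (deriv ^^ (p - 1)) g 1 - ?c"
    using shifted by (simp add: integral_unique)
  have "asym_deg ?G = - 1"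
    unfolding asym_deg_def using Least_eq_0[of "\<lambda>q. ((fdiff ^^ q) ?G \<longlongrightarrow> 0) at_top"] lim by simp
  moreover have "gregory_coeff 0 = 1" by (simp add: gregory_coeff_def)
  moreover have "prin_sum ?G 1 = 0"
    using prin_sum_of_deriv[OF g, of 1] prin_sum_deriv_degree_1[OF lim] by simp
  ultimately show "gen_euler_const ?G = asym_const ?G"
    using int ac by (simp add: gen_euler_const_def binet_fun_def)
qed

lemma normally_summable_eulerian_deriv_all:
  assumes g: "g \<in> C_class p \<inter> D_class p \<inter> K_class p" and h: "g \<in> C_class n \<inter> K_class n"
    and "m \<le> n"
  shows "normally_summable (\<lambda>k. eulerian_deriv p g (Suc k) m)"
proof (cases "m \<le> p")
  case True
  show ?thesis
    by (rule normally_summable_eulerian_deriv[OF _ K_class_imp_eventually_monotone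
          degree_deriv_tendsto_0[OF g] True]) (use g in auto)
next
  case False
  show ?thesis
    by (rule normally_summable_eulerian_deriv_above[OF _ K_class_imp_eventually_monotone
          degree_deriv_tendsto_0[OF g] _ \<open>m \<le> n\<close>]) (use h False in auto)
qed

lemma prin_sum_in_C_class:
  assumes g: "g \<in> C_class p \<inter> D_class p \<inter> K_class p" and p: "p \<ge> 1" and deg: "asym_deg g = int p - 1"
    and h: "g \<in> C_class n \<inter> K_class n"
  shows "prin_sum g \<in> C_class n"
    and "\<And>m x. m \<le> n \<Longrightarrow> x > 0 \<Longrightarrow> (deriv ^^ m) (prin_sum g) x = prin_sum_deriv p g m x"
proof -
  have C: "g \<in> C_class n" using h by simp
  note norm = normally_summable_eulerian_deriv_all[OF g h]
  have tower: "derivative_tower n (prin_sum_deriv p g) {0<..}"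
    by (rule prin_sum_deriv_tower[OF C norm])
  have eq: "prin_sum g x = prin_sum_deriv p g 0 x" if "x > 0" for x
    using prin_sum_eq(1)[OF g p deg] that by simp
  show "prin_sum g \<in> C_class n"
    by (rule C_classI_tower[OF tower eq prin_sum_deriv_continuous_on[OF C norm[OF order_refl]]])
  show "(deriv ^^ m) (prin_sum g) x = prin_sum_deriv p g m x" if "m \<le> n" "x > 0" for m x
    by (rule higher_deriv_eq_tower[OF open_greaterThan tower _ that(1)]) (use eq that in auto)
qed

lemma termwise_differentiable_eulerian:
  assumes g: "g \<in> C_class p \<inter> D_class p \<inter> K_class p" and h: "g \<in> C_class n \<inter> K_class n"
  shows "termwise_differentiable_on n (\<lambda>k. eulerian_term p g (Suc k)) {0..}"
proof -
  have C: "g \<in> C_class n" using h by simp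
  note norm = normally_summable_eulerian_deriv_all[OF g h]
  have eq: "(deriv ^^ m) (eulerian_term p g (Suc k)) x = eulerian_deriv p g (Suc k) m x"
    if "m \<le> n" "x \<ge> 0" for m k x
    by (rule higher_deriv_eq_tower[OF open_greaterThan eulerian_deriv_tower[OF C] _ that(1)])
       (use that in \<open>auto simp: eulerian_term_eq\<close>)
  have der: "((deriv ^^ m) (eulerian_term p g (Suc k)) has_real_derivative
      eulerian_deriv p g (Suc k) (Suc m) x) (at x)" if "m < n" "x \<ge> 0" for m k x
    by (rule higher_deriv_has_derivative[OF open_greaterThan eulerian_deriv_tower[OF C] _ that(1)])
       (use that in \<open>auto simp: eulerian_term_eq\<close>)
  show ?thesis
    unfolding termwise_differentiable_on_def
  proof (intro conjI allI impI ballI)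
    fix m x assume "m \<le> n" "x \<in> {0::real..}"
    then show "summable (\<lambda>k. (deriv ^^ m) (eulerian_term p g (Suc k)) x)"
      using normally_summable_imp_summable[OF norm, of m x] by (simp add: eq)
  next
    fix m x k assume "m < n" "x \<in> {0::real..}"
    then show "(deriv ^^ m) (eulerian_term p g (Suc k)) differentiable (at x)"
      using der[of m x k] unfolding real_differentiable_def by auto
  next
    fix m x assume m: "m < n" and x: "x \<in> {0::real..}"
    have "((\<lambda>x. \<Sum>k. eulerian_deriv p g (Suc k) m x) has_real_derivative
        (\<Sum>k. eulerian_deriv p g (Suc k) (Suc m) x)) (at x within {0..})"
      by (rule normally_summable_has_derivative[OF norm norm eulerian_deriv_has_derivative[OF C]])
         (use m x in auto)
    moreover have "(\<Sum>k. (deriv ^^ Suc m) (eulerian_term p g (Suc k)) x)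
        = (\<Sum>k. eulerian_deriv p g (Suc k) (Suc m) x)"
      by (rule suminf_cong, rule eq) (use m x in auto)
    ultimately have "((\<lambda>x. \<Sum>k. eulerian_deriv p g (Suc k) m x) has_real_derivative
        (\<Sum>k. (deriv ^^ Suc m) (eulerian_term p g (Suc k)) x)) (at x within {0..})"
      by (simp only:)
    then show "((\<lambda>y. \<Sum>k. (deriv ^^ m) (eulerian_term p g (Suc k)) y) has_real_derivative
        (\<Sum>k. (deriv ^^ Suc m) (eulerian_term p g (Suc k)) x)) (at x within {0..})"
    proof (rule has_field_derivative_transform_within[OF _ zero_less_one x])
      fix y :: real assume "y \<in> {0..}"
      then show "(\<Sum>k. eulerian_deriv p g (Suc k) m y) = (\<Sum>k. (deriv ^^ m) (eulerian_term p g (Suc k)) y)"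
        by (intro suminf_cong eq[symmetric]) (use m in auto)
    qed
  qed
qed

theorem theorem8p7:
  fixes g :: "real \<Rightarrow> real" and p :: nat
  assumes "p \<ge> 1"
    and "g \<in> C_class p \<inter> D_class p \<inter> K_class p"
    and "asym_deg g = int p - 1"
  shows
    "(gen_euler_const ((deriv ^^ p) g) = asym_const ((deriv ^^ p) g)
      \<and> asym_const ((deriv ^^ p) g) = (deriv ^^ (p - 1)) g 1 - (deriv ^^ p) (prin_sum g) 1)
   \<and> ((\<forall>x>0. prin_sum g x =
          (\<Sum>j\<in>{1..p - 1}. (x gchoose j) * (fdiff ^^ (j - 1)) g 1)
          + (x gchoose p) * (deriv ^^ p) (prin_sum g) 1 - g x
          - (\<Sum>k. eulerian_term p g (Suc k) x))
      \<and> (\<forall>S. bounded S \<and> S \<subseteq> {0..} \<longrightarrow>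
           uniform_limit S (\<lambda>n x. \<Sum>k<n. eulerian_term p g (Suc k) x)
             (\<lambda>x. \<Sum>k. eulerian_term p g (Suc k) x) sequentially))
   \<and> (prin_sum g \<in> C_class p
      \<and> (\<forall>I. is_interval I \<and> bounded I \<and> I \<subseteq> {0..} \<longrightarrow>
           termwise_integrable_on (\<lambda>k. eulerian_term p g (Suc k)) I))
   \<and> (\<forall>r. g \<in> C_class (max p r) \<inter> K_class (max p r) \<longrightarrow>
        prin_sum g \<in> C_class (max p r)
        \<and> termwise_differentiable_on (max p r) (\<lambda>k. eulerian_term p g (Suc k)) {0..})"
proof -
  note p = assms(1) and g = assms(2) and deg = assms(3)
  have h: "g \<in> C_class p \<inter> K_class p" using g by blast
  have const: "(deriv ^^ p) (prin_sum g) 1 = eulerian_const p g"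
    using prin_sum_in_C_class(2)[OF g p deg h, of p 1]
      prin_sum_deriv_degree_1[OF degree_deriv_tendsto_0[OF g]] by simp
  have norm: "normally_summable (\<lambda>k. eulerian_term p g (Suc k))"
    unfolding eulerian_term_eq by (rule normally_summable_eulerian_deriv_all[OF g h]) simp
  have cont: "continuous_on {0..} (eulerian_term p g (Suc k))" for k
  proof -
    have "g \<in> C_class 0" using g by (intro C_class_mono[of 0 p]) auto
    then show ?thesis unfolding eulerian_term_eq by (rule eulerian_deriv_continuous_on)
  qed
  show ?thesis unfolding const
  proof (intro conjI allI impI; (elim conjE)?)
    show "gen_euler_const ((deriv ^^ p) g) = asym_const ((deriv ^^ p) g)"
      "asym_const ((deriv ^^ p) g) = (deriv ^^ (p - 1)) g 1 - eulerian_const p g"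
      by (rule asym_const_of_deriv[OF g p deg])+
    show "prin_sum g x = (\<Sum>j\<in>{1..p - 1}. (x gchoose j) * (fdiff ^^ (j - 1)) g 1)
          + (x gchoose p) * eulerian_const p g - g x - (\<Sum>k. eulerian_term p g (Suc k) x)"
      if "x > 0" for x
      using prin_sum_eq(1)[OF g p deg, of x] that unfolding prin_sum_deriv_0 by simp
    show "uniform_limit S (\<lambda>n x. \<Sum>k<n. eulerian_term p g (Suc k) x)
        (\<lambda>x. \<Sum>k. eulerian_term p g (Suc k) x) sequentially" if "bounded S" "S \<subseteq> {0..}" for S
      by (rule normally_summable_uniform_limit[OF norm that])
    show "prin_sum g \<in> C_class p" by (rule prin_sum_in_C_class(1)[OF g p deg h])
    show "termwise_integrable_on (\<lambda>k. eulerian_term p g (Suc k)) I"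
      if "bounded I" "I \<subseteq> {0..}" for I
      by (rule termwise_integrable_on_normally_summable[OF norm cont that])
    fix r assume r: "g \<in> C_class (max p r) \<inter> K_class (max p r)"
    show "prin_sum g \<in> C_class (max p r)" by (rule prin_sum_in_C_class(1)[OF g p deg r])
    show "termwise_differentiable_on (max p r) (\<lambda>k. eulerian_term p g (Suc k)) {0..}"
      by (rule termwise_differentiable_eulerian[OF g r])
  qed
qed

end
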